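(* Let $v$ be a unit vector in $\mathbb{R}^n$, and for $r>0$ let $Y^{2n}(r,v):=\mathbb{T}^n\times(-r,r)v\times v^\perp\subset T^*\mathbb{T}^n$. Then the following holds. (1) If $v$ is a scalar multiple of an integer vector $\alpha\in\mathbb{Z}^n\setminus\{0\}$, then $$C_{\rm BPS}(Y^{2n}(r,v),\mathbb{T}^n;\pm\alpha)=r\|\alpha\|,$$ and for all $\beta\in\mathbb{Z}^n\setminus\mathrm{span}_{\mathbb{R}}\{\alpha\}$ and all $r>0$, $$C_{\rm BPS}(Y^{2n}(r,v),\mathbb{T}^n;\beta)=\infty.$$ (2) If $v$ is not a scalar multiple of any integer vector, then for all $\alpha\in H_1(\mathbb{T}^n,\mathbb{Z})\setminus\{0\}$ and all $r>0$, $$C_{\rm BPS}(Y^{2n}(r,v),\mathbb{T}^n;\alpha)=\infty.$$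
   Context: $S^1=\mathbb{R}/\mathbb{Z}$, $\mathbb{T}^n=\mathbb{R}^n/\mathbb{Z}^n$, $T^*\mathbb{T}^n=\mathbb{T}^n\times\mathbb{R}^n\ni(q,p)$ with $\omega_0=\sum_idp_i\wedge dq_i$; $(-r,r)v\times v^\perp=\{\tau v+w:|\tau|<r,\ w\perp v\}\subset\mathbb{R}^n$; $\|\cdot\|$ is the Euclidean norm; free homotopy classes of loops are identified with $H_1(\mathbb{T}^n,\mathbb{Z})=\mathbb{Z}^n$; $\mathbb{T}^n\subset T^*\mathbb{T}^n$ denotes the zero section. BPS capacity: for a Hamiltonian $H:S^1\times T^*\mathbb{T}^n\to\mathbb{R}$, $\mathscr{P}_\alpha(H)$ is the set of loops $z=(q,p):S^1\to T^*\mathbb{T}^n$ in class $\alpha$ with $\dot q=\partial_pH$, $\dot p=-\partial_qH$. For $c>0$, an open set $W\subset T^*\mathbb{T}^n$ and a compact set $A\subset W$, let $\mathscr{K}_c(W,A)=\{H\in C_0^\infty(S^1\times W):\sup_{S^1\times A}H\le-c\}$ (extended by $0$), and $$C_{\rm BPS}(W,A;\alpha)=\inf\{c>0:\ \mathscr{P}_\alpha(H)\neq\emptyset\ \text{ for all }H\in\mathscr{K}_c(W,A)\},\qquad\inf\emptyset=\infty.$$ *)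

theory Defs
  imports "HOL-Analysis.Analysis"
begin

section \<open>The circle and the torus\<close>

lemma int_chain: "x - z \<in> \<int>" if "x - y \<in> \<int>" "y - z \<in> \<int>" for x y z :: real
  using Ints_add[OF that] by simp

quotient_type circle = real / "\<lambda>x y. x - y \<in> \<int>"
  morphisms rep_circle circle_of
proof (rule equivpI)
  show "reflp (\<lambda>x y::real. x - y \<in> \<int>)" by (simp add: reflp_def)
  show "symp (\<lambda>x y::real. x - y \<in> \<int>)"
    by (rule sympI) (metis Ints_minus minus_diff_eq)
  show "transp (\<lambda>x y::real. x - y \<in> \<int>)"
    by (rule transpI) (blast intro: int_chain)
qed

quotient_type 'n torus = "(real, 'n::finite) vec" / "\<lambda>x y. \<forall>i. x $ i - y $ i \<in> \<int>"
  morphisms rep_torus torus_of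
proof (rule equivpI)
  show "reflp (\<lambda>x y::real^'n. \<forall>i. x $ i - y $ i \<in> \<int>)" by (simp add: reflp_def)
  show "symp (\<lambda>x y::real^'n. \<forall>i. x $ i - y $ i \<in> \<int>)"
    by (rule sympI) (metis Ints_minus minus_diff_eq)
  show "transp (\<lambda>x y::real^'n. \<forall>i. x $ i - y $ i \<in> \<int>)"
    by (rule transpI) (blast intro: int_chain)
qed

text \<open>Both quotients carry the quotient topology; products of them carry the product topology
  of the library.\<close>

instantiation circle :: topological_space
begin

definition open_circle_def: "open U \<longleftrightarrow> open (circle_of -` U)"

instance
proof
  show "open (UNIV :: circle set)" by (simp add: open_circle_def)
  show "open (S \<inter> T)" if "open S" "open T" for S T :: "circle set"
    using that by (auto simp: open_circle_def vimage_Int)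
  show "open (\<Union> K)" if "\<forall>S\<in>K. open S" for K :: "circle set set"
    using that by (auto simp: open_circle_def vimage_Union)
qed

end

instantiation torus :: (finite) topological_space
begin

definition open_torus_def: "open U \<longleftrightarrow> open (torus_of -` U)"

instance
proof
  show "open (UNIV :: 'a torus set)" by (simp add: open_torus_def)
  show "open (S \<inter> T)" if "open S" "open T" for S T :: "'a torus set"
    using that by (auto simp: open_torus_def vimage_Int)
  show "open (\<Union> K)" if "\<forall>S\<in>K. open S" for K :: "'a torus set set"
    using that by (auto simp: open_torus_def vimage_Union)
qed

end

text \<open>The cotangent bundle of the torus, with points written \<open>(q, p)\<close>.\<close>

type_synonym 'n cotangent = "'n torus \<times> (real^'n)"

text \<open>The inclusion of the integer lattice, i.e. of the first homology group of the torus,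
  into Euclidean space.\<close>

definition real_vec :: "int^'n \<Rightarrow> real^'n" where
  "real_vec \<alpha> = (\<chi> i. of_int (\<alpha> $ i))"

section \<open>Smooth functions\<close>

text \<open>\<open>Ck k f\<close>: \<open>f\<close> is \<open>k\<close> times continuously differentiable. For \<open>k > 0\<close>, all directional
  derivatives of \<open>f\<close> must be of class \<open>k - 1\<close>.\<close>

primrec Ck :: "nat \<Rightarrow> ('a::euclidean_space \<Rightarrow> real) \<Rightarrow> bool" where
  "Ck 0 f \<longleftrightarrow> continuous_on UNIV f"
| "Ck (Suc k) f \<longleftrightarrow>
     (\<forall>x. f differentiable (at x)) \<and> (\<forall>v. Ck k (\<lambda>x. frechet_derivative f (at x) v))"

definition smooth :: "('a::euclidean_space \<Rightarrow> real) \<Rightarrow> bool" where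
  "smooth f \<longleftrightarrow> (\<forall>k. Ck k f)"

text \<open>The projection of \<open>\<real> \<times> \<real>\<^sup>n \<times> \<real>\<^sup>n\<close> onto \<open>S\<^sup>1 \<times> T\<^sup>*\<bbbT>\<^sup>n\<close> is the universal covering, so a
  function downstairs is smooth iff its pullback is, and derivatives in \<open>q\<close> and \<open>p\<close> may be
  computed upstairs.\<close>

definition pullback :: "(circle \<times> ('n::finite) cotangent \<Rightarrow> real) \<Rightarrow> real \<times> (real^'n) \<times> (real^'n) \<Rightarrow> real"
  where "pullback H = (\<lambda>(t, q, p). H (circle_of t, torus_of q, p))"

section \<open>Periodic orbits\<close>

definition lift_of_loop ::
    "(circle \<Rightarrow> ('n::finite) cotangent) \<Rightarrow> (real \<Rightarrow> real^'n) \<Rightarrow> (real \<Rightarrow> real^'n) \<Rightarrow> bool" where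
  "lift_of_loop z q p \<longleftrightarrow>
     continuous_on UNIV q \<and> continuous_on UNIV p \<and>
     (\<forall>t. z (circle_of t) = (torus_of (q t), p t))"

text \<open>Hamilton's equations \<open>q' = \<partial>\<^sub>p H\<close>, \<open>p' = - \<partial>\<^sub>q H\<close> for the lift of a curve.\<close>

definition hamilton_eqs ::
    "(circle \<times> ('n::finite) cotangent \<Rightarrow> real) \<Rightarrow> (real \<Rightarrow> real^'n) \<Rightarrow> (real \<Rightarrow> real^'n) \<Rightarrow> bool" where
  "hamilton_eqs H q p \<longleftrightarrow>
     (\<forall>t. \<exists>q' p'.
        (q has_vector_derivative q') (at t) \<and>
        (p has_vector_derivative p') (at t) \<and>
        GDERIV (\<lambda>y. pullback H (t, q t, y)) (p t) :> q' \<and>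
        GDERIV (\<lambda>x. pullback H (t, x, p t)) (q t) :> - p')"

text \<open>A loop in \<open>T\<^sup>*\<bbbT>\<^sup>n\<close> is in the class \<open>\<alpha>\<close> iff the base component of a lift is translated by
  \<open>\<alpha>\<close> over one period; the fibre component of a lift is automatically periodic.\<close>

definition periodic_orbits ::
    "int^'n \<Rightarrow> (circle \<times> ('n::finite) cotangent \<Rightarrow> real) \<Rightarrow> (circle \<Rightarrow> 'n cotangent) set" where
  "periodic_orbits \<alpha> H =
     {z. \<exists>q p. lift_of_loop z q p \<and> (\<forall>t. q (t + 1) = q t + real_vec \<alpha>) \<and> hamilton_eqs H q p}"

section \<open>The BPS capacity\<close>

text \<open>Compactly supported smooth functions on \<open>S\<^sup>1 \<times> W\<close>, extended by zero.\<close>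

definition compactly_supported_smooth ::
    "('n::finite) cotangent set \<Rightarrow> (circle \<times> 'n cotangent \<Rightarrow> real) set" where
  "compactly_supported_smooth W =
     {H. smooth (pullback H) \<and> compact (closure {x. H x \<noteq> 0}) \<and>
         closure {x. H x \<noteq> 0} \<subseteq> UNIV \<times> W}"

definition BPS_class ::
    "real \<Rightarrow> ('n::finite) cotangent set \<Rightarrow> 'n cotangent set \<Rightarrow> (circle \<times> 'n cotangent \<Rightarrow> real) set" where
  "BPS_class c W A =
     {H \<in> compactly_supported_smooth W. (SUP x\<in>UNIV \<times> A. ereal (H x)) \<le> ereal (- c)}"

definition C_BPS :: "('n::finite) cotangent set \<Rightarrow> 'n cotangent set \<Rightarrow> int^'n \<Rightarrow> ereal" where
  "C_BPS W A \<alpha> = Inf {ereal c | c. c > 0 \<and> (\<forall>H\<in>BPS_class c W A. periodic_orbits \<alpha> H \<noteq> {})}"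

section \<open>The domains\<close>

definition Y :: "real \<Rightarrow> real^'n \<Rightarrow> ('n::finite) cotangent set" where
  "Y r v = UNIV \<times> {\<tau> *\<^sub>R v + w | \<tau> w. \<bar>\<tau>\<bar> < r \<and> orthogonal w v}"

definition zero_section :: "('n::finite) cotangent set" where
  "zero_section = UNIV \<times> {0}"

text \<open>The capacity is applied to an open set and a compact subset of it.\<close>

lemma continuous_on_torus_of: "continuous_on UNIV torus_of"
  by (simp add: continuous_on_open_vimage open_torus_def)

lemma compact_zero_section: "compact (zero_section :: ('n::finite) cotangent set)"
proof -
  have "x \<in> torus_of ` cbox 0 1" for x :: "'n torus"
  proof -
    obtain y where y: "x = torus_of y"
      using Quotient3_abs_rep[OF Quotient3_torus, of x] that by metis
    have "torus_of y = torus_of (\<chi> i. frac (y $ i))"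
      unfolding torus.abs_eq_iff by (simp add: frac_def)
    moreover have "(\<chi> i. frac (y $ i)) \<in> cbox 0 (1::real^'n)"
      unfolding mem_box_cart by (simp add: less_imp_le[OF frac_lt_1])
    ultimately show ?thesis using y by blast
  qed
  then have "(UNIV :: 'n torus set) = torus_of ` cbox 0 1" by auto
  moreover have "compact (torus_of ` cbox 0 (1::real^'n))"
    by (intro compact_continuous_image compact_cbox)
      (rule continuous_on_subset[OF continuous_on_torus_of], simp)
  ultimately have "compact (UNIV :: 'n torus set)" by simp
  then show ?thesis
    unfolding zero_section_def by (intro compact_Times) auto
qed

lemma Y_eq:
  fixes v :: "real^'n"
  assumes "norm v = 1"
  shows "Y r v = UNIV \<times> {p. \<bar>p \<bullet> v\<bar> < r}"
proof -
  have vv: "v \<bullet> v = 1" using assms by (simp add: norm_eq_1)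
  have "\<exists>\<tau> w. p = \<tau> *\<^sub>R v + w \<and> \<bar>\<tau>\<bar> < r \<and> orthogonal w v" if "\<bar>p \<bullet> v\<bar> < r" for p
    by (rule exI[of _ "p \<bullet> v"], rule exI[of _ "p - (p \<bullet> v) *\<^sub>R v"])
      (use that vv in \<open>simp add: orthogonal_def inner_diff_left\<close>)
  then show ?thesis
    using vv by (auto simp: Y_def orthogonal_def inner_add_left)
qed

lemma open_Y: "norm v = 1 \<Longrightarrow> open (Y r v)"
  unfolding Y_eq by (intro open_Times open_UNIV open_Collect_less continuous_intros)

lemma zero_section_subset_Y: "norm v = 1 \<Longrightarrow> r > 0 \<Longrightarrow> zero_section \<subseteq> Y r v"
  by (auto simp: Y_eq zero_section_def)

end

theory Submission
  imports Defs
begin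

text \<open>
  The capacity is an infimum over depths \<open>c\<close>. It is bounded from below by exhibiting deep
  Hamiltonians without orbits in the given class, and from above by proving that sufficiently deep
  Hamiltonians have one.

  Lower bounds (\<open>C_BPS_ge\<close>, \<open>C_BPS_infinite\<close>). If \<open>H\<close> depends only on \<open>p\<close>, then \<open>p\<close> is constant along
  orbits and \<open>q\<close> moves with velocity \<open>\<nabla>H\<close>. An orbit in class \<open>\<alpha>\<close> therefore requires a point where
  \<open>\<nabla>H\<close> equals \<open>\<alpha>\<close>. A tent of depth \<open>c\<close> over the strip has slope about \<open>c / r\<close> along \<open>v\<close>, and in the
  directions orthogonal to \<open>v\<close>, in which the strip is unbounded, the slope can be made as small as
  desired. So the class of \<open>v\<close>-component \<open>m\<close> is missed if \<open>c < r \<bar>m\<bar>\<close>, and a class that is not a multiple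
  of \<open>v\<close> is missed for every \<open>c\<close>.

  Upper bound (\<open>periodic_orbit_exists\<close>). Let \<open>\<alpha> = lam v\<close> with \<open>lam > 0\<close>, and \<open>H \<le> - c\<close> on the zero section with
  \<open>c > r lam\<close>. Closed orbits in class \<open>\<alpha>\<close> are the critical points of the action
  \<open>\<integral> p dq - H dt\<close> on loops \<open>q(t) = q\<^sub>0 + t \<alpha> + x(t)\<close>. On loops in the zero section the action is at least
  \<open>c\<close>. These loops link the boundary of the disc of all loops with \<open>x' = - A (p - mean p)\<close>
  with fixed starting point and \<open>mean p \<bullet> v \<le> r\<close>. On its boundary \<open>mean p \<bullet> v = r\<close> the action is at most \<open>r lam\<close>: the
  term \<open>\<integral> p \<bullet> x' = - A \<integral> \<parallel>p - mean p\<parallel>\<^sup>2\<close> outweighs \<open>- H\<close>, because \<open>H\<close> vanishes near the wall \<open>p \<bullet> v = r\<close>.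
  A minimax over deformations of the disc then gives a critical value at least \<open>c\<close>.

  To make this finite dimensional, time is discretised into \<open>N\<close> steps; critical points of the discrete action
  are closed orbits of the symplectic Euler scheme. The deformation is iterated gradient descent
  with a small step, which is a continuous map; that it cannot remove the
  intersection with the zero section is the Poincare-Miranda theorem
  (\<open>linking\<close>). This produces almost critical points for every \<open>N\<close> (\<open>almost_critical\<close>), and as \<open>N\<close> grows,
  the almost closed orbits accumulate at a closed orbit (\<open>Euler_limit\<close>); its class survives since
  lifts converge pointwise.
\<close>

section \<open>Smooth functions and rounded ramps\<close>

lemma Ck_Suc_D: "Ck (Suc k) f \<Longrightarrow> Ck k f"
proof (induction k arbitrary: f)
  case 0
  then have "\<And>x. f differentiable (at x)" by simp
  then have "continuous_on UNIV f"
    by (simp add: continuous_on_eq_continuous_within differentiable_imp_continuous_within)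
  then show ?case by simp
next
  case (Suc k)
  have "\<forall>x. f differentiable (at x)" using Suc.prems by simp
  moreover have "\<forall>v. Ck k (\<lambda>x. frechet_derivative f (at x) v)"
    using Suc.prems Suc.IH by (metis Ck.simps(2))
  ultimately show ?case by simp
qed

lemma Ck_SucI:
  assumes "\<And>x. (f has_derivative f' x) (at x)" and "\<And>v. Ck k (\<lambda>x. f' x v)"
  shows "Ck (Suc k) f"
proof -
  have "frechet_derivative f (at x) = f' x" for x
    using frechet_derivative_at[OF assms(1)] by simp
  then show ?thesis using assms by (auto simp: differentiable_def)
qed

lemma Ck_SucD:
  assumes "Ck (Suc k) f"
  shows "(f has_derivative frechet_derivative f (at x)) (at x)"
    and "Ck k (\<lambda>x. frechet_derivative f (at x) v)"
  using assms by (auto simp: frechet_derivative_works[symmetric])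

lemma Ck_const: "Ck k (\<lambda>x. c)"
proof (induction k arbitrary: c)
  case (Suc k)
  show ?case by (rule Ck_SucI[where f' = "\<lambda>x v. 0"]) (use Suc in auto)
qed simp

lemma Ck_linear: "bounded_linear f \<Longrightarrow> Ck k f"
proof (induction k)
  case 0
  then show ?case by (simp add: linear_continuous_on)
next
  case (Suc k)
  show ?case
    by (rule Ck_SucI[where f' = "\<lambda>x. f"])
      (auto intro: Ck_const bounded_linear_imp_has_derivative Suc.prems)
qed

lemma Ck_add: "Ck k f \<Longrightarrow> Ck k g \<Longrightarrow> Ck k (\<lambda>x. f x + g x)"
proof (induction k arbitrary: f g)
  case 0
  then show ?case by (auto intro: continuous_on_add)
next
  case (Suc k)
  show ?case
    by (rule Ck_SucI, rule has_derivative_add)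
      (use Ck_SucD[OF Suc.prems(1)] Ck_SucD[OF Suc.prems(2)] Suc.IH in auto)
qed

lemma Ck_mult: "Ck k f \<Longrightarrow> Ck k g \<Longrightarrow> Ck k (\<lambda>x. f x * g x)"
proof (induction k arbitrary: f g)
  case 0
  then show ?case by (auto intro: continuous_on_mult)
next
  case (Suc k)
  show ?case
    by (rule Ck_SucI, rule has_derivative_mult)
      (use Ck_SucD[OF Suc.prems(1)] Ck_SucD[OF Suc.prems(2)] Suc.IH
        Ck_Suc_D[OF Suc.prems(1)] Ck_Suc_D[OF Suc.prems(2)] in \<open>auto intro!: Ck_add\<close>)
qed

lemma Ck_sum: "finite S \<Longrightarrow> (\<And>i. i \<in> S \<Longrightarrow> Ck k (f i)) \<Longrightarrow> Ck k (\<lambda>x. \<Sum>i\<in>S. f i x)"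
  by (induction S rule: finite_induct) (auto intro: Ck_const Ck_add)

lemma Ck_diff: "Ck k f \<Longrightarrow> Ck k g \<Longrightarrow> Ck k (\<lambda>x. f x - g x)"
  using Ck_add[of k f "\<lambda>x. - 1 * g x"] Ck_mult[OF Ck_const[of k "- 1"], of g] by simp

text \<open>Real powers are handled with the exponent universally quantified: differentiating
  lowers the exponent by one, so only the statement for all exponents is inductive.\<close>

lemma Ck_powr:
  assumes "\<And>x. f x > 0"
  shows "Ck k f \<Longrightarrow> Ck k (\<lambda>x. f x powr s)"
proof (induction k arbitrary: s)
  case 0
  have "f x \<noteq> 0" for x using assms[of x] by simp
  with 0 show ?case by (auto intro!: continuous_on_powr)
next
  case (Suc k)
  note D = Ck_SucD[OF Suc.prems]
  have "((\<lambda>x. f x powr s) has_derivative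
     (\<lambda>h. s * (f x powr (s - 1)) * frechet_derivative f (at x) h)) (at x)" for x
  proof -
    have "DERIV (\<lambda>y. y powr s) (f x) :> s * (f x powr (s - 1))"
      using assms[of x] by (auto intro!: derivative_eq_intros)
    then show ?thesis
      using has_derivative_compose[OF D(1)[of x], of "\<lambda>y. y powr s" "(*) (s * f x powr (s - 1))"]
      by (simp add: has_field_derivative_def)
  qed
  moreover have "Ck k (\<lambda>x. s * (f x powr (s - 1)) * frechet_derivative f (at x) v)" for v
    by (intro Ck_mult Ck_const Suc.IH Ck_Suc_D[OF Suc.prems] D(2))
  ultimately show ?case by (rule Ck_SucI)
qed

text \<open>The space of functions \<open>x \<mapsto> P (1 / x) e\<^sup>-\<^sup>1\<^sup>/\<^sup>x\<close>, extended by zero to the left, with \<open>P\<close> a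
  polynomial, is closed under differentiation. This is what makes \<open>e\<^sup>-\<^sup>1\<^sup>/\<^sup>x\<close> smooth at the origin, and
  an induction over the order of differentiability can stay inside this space.\<close>

definition flat :: "real poly \<Rightarrow> real \<Rightarrow> real" where
  "flat P x = (if x > 0 then poly P (1 / x) * exp (- (1 / x)) else 0)"

lemma poly_exp_decay: "((\<lambda>y::real. poly P y * exp (- y)) \<longlongrightarrow> 0) at_top"
proof -
  have "((\<lambda>y::real. \<Sum>i\<le>degree P. coeff P i * (y ^ i / exp y)) \<longlongrightarrow> (\<Sum>i\<le>degree P. coeff P i * 0)) at_top"
    by (intro tendsto_intros tendsto_power_div_exp_0)
  moreover have "(\<Sum>i\<le>degree P. coeff P i * (y ^ i / exp y)) = poly P y * exp (- y)" for y
    by (simp add: poly_altdef sum_distrib_right exp_minus divide_inverse mult.assoc)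
  ultimately show ?thesis by simp
qed

text \<open>With \<open>y = 1 / x\<close> one has \<open>dy/dx = - y\<^sup>2\<close>, whence the new polynomial \<open>y\<^sup>2 (P - P')\<close>. At the
  origin the difference quotient from the right is \<open>y P(y) e\<^sup>-\<^sup>y\<close>, which vanishes as \<open>y\<close> tends to infinity.\<close>

lemma flat_deriv: "(flat P has_real_derivative flat (monom 1 2 * (P - pderiv P)) x) (at x)"
proof -
  consider "x > 0" | "x < 0" | "x = 0" by linarith
  then show ?thesis
  proof cases
    case 1
    have "((\<lambda>x. poly P (1 / x) * exp (- (1 / x))) has_real_derivative
        flat (monom 1 2 * (P - pderiv P)) x) (at x)"
      using 1 by (auto intro!: derivative_eq_intros DERIV_chain'[OF _ poly_DERIV]
          simp: flat_def poly_monom power2_eq_square field_simps)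
    then show ?thesis
      by (rule has_field_derivative_transform_within_open[where S = "{0<..}"])
        (use 1 in \<open>auto simp: flat_def\<close>)
  next
    case 2
    have "((\<lambda>x. 0) has_real_derivative flat (monom 1 2 * (P - pderiv P)) x) (at x)"
      using 2 by (simp add: flat_def)
    then show ?thesis
      by (rule has_field_derivative_transform_within_open[where S = "{..<0}"])
        (use 2 in \<open>auto simp: flat_def\<close>)
  next
    case 3
    have "((\<lambda>h. flat P h / h) \<longlongrightarrow> 0) (at_right 0)"
    proof -
      have "((\<lambda>h. poly (pCons 0 P) (inverse h) * exp (- inverse h)) \<longlongrightarrow> 0) (at_right (0::real))"
        by (rule filterlim_compose[OF poly_exp_decay filterlim_inverse_at_top_right])
      moreover have "\<forall>\<^sub>F h in at_right (0::real).
          poly (pCons 0 P) (inverse h) * exp (- inverse h) = flat P h / h"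
        unfolding eventually_at_right_field
        by (rule exI[of _ 1]) (auto simp: flat_def field_simps)
      ultimately show ?thesis by (rule Lim_transform_eventually)
    qed
    moreover have "((\<lambda>h. flat P h / h) \<longlongrightarrow> 0) (at_left 0)"
      by (rule Lim_transform_eventually[of "\<lambda>h. 0"])
        (auto simp: eventually_at_left_field flat_def intro!: exI[of _ "-1"])
    ultimately have "((\<lambda>h. flat P h / h) \<longlongrightarrow> 0) (at 0)"
      by (simp add: filterlim_split_at_real)
    then show ?thesis
      using 3 by (simp add: DERIV_def flat_def)
  qed
qed

lemma Ck_flat: "Ck k f \<Longrightarrow> Ck k (\<lambda>x. flat P (f x))"
proof (induction k arbitrary: P)
  case 0
  have "continuous_on UNIV (flat P)"
    by (meson DERIV_continuous_on flat_deriv)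
  then show ?case using 0 continuous_on_compose2[of UNIV "flat P" UNIV f] by simp
next
  case (Suc k)
  note D = Ck_SucD[OF Suc.prems]
  let ?Q = "monom 1 2 * (P - pderiv P)"
  have "((\<lambda>x. flat P (f x)) has_derivative
      (\<lambda>h. flat ?Q (f x) * frechet_derivative f (at x) h)) (at x)" for x
    using has_derivative_compose[OF D(1)[of x] flat_deriv[unfolded has_field_derivative_def]] .
  moreover have "Ck k (\<lambda>x. flat ?Q (f x) * frechet_derivative f (at x) v)" for v
    by (intro Ck_mult Ck_const Suc.IH Ck_Suc_D[OF Suc.prems] D(2))
  ultimately show ?case by (rule Ck_SucI)
qed

text \<open>A smooth substitute for the positive part \<open>max 0 x\<close>: the function \<open>x e\<^sup>-\<^sup>d\<^sup>/\<^sup>x\<close> for \<open>x > 0\<close>, zero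
  otherwise. Its slope stays between 0 and 1 because \<open>(1 + y) e\<^sup>-\<^sup>y \<le> 1\<close>, and it converges to
  \<open>max 0 x\<close> as \<open>d\<close> tends to zero. Slopes that never exceed 1 are essential, since the capacity
  is decided by slopes.\<close>

definition ramp :: "real \<Rightarrow> real \<Rightarrow> real" where
  "ramp d x = x * flat 1 (x / d)"

definition ramp' :: "real \<Rightarrow> real \<Rightarrow> real" where
  "ramp' d x = (if x > 0 then (1 + d / x) * exp (- (d / x)) else 0)"

lemma ramp_deriv:
  assumes "d > 0" shows "(ramp d has_real_derivative ramp' d x) (at x)"
proof -
  let ?Q = "monom 1 2 * (1 - pderiv (1 :: real poly))"
  have "((\<lambda>x. x * flat 1 (x / d)) has_real_derivative
      (1 * flat 1 (x / d) + (flat ?Q (x / d) * (1 / d)) * x)) (at x)"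
    by (rule DERIV_mult, rule DERIV_ident, rule DERIV_chain'[OF _ flat_deriv])
      (use assms in \<open>auto intro!: derivative_eq_intros\<close>)
  moreover have "1 * flat 1 (x / d) + (flat ?Q (x / d) * (1 / d)) * x = ramp' d x"
    using assms
    by (auto simp: flat_def ramp'_def poly_monom power2_eq_square field_simps zero_less_divide_iff)
  ultimately show ?thesis by (simp add: ramp_def[abs_def])
qed

lemma Ck_ramp: "Ck k f \<Longrightarrow> Ck k (\<lambda>x. ramp d (f x))"
  unfolding ramp_def divide_inverse by (intro Ck_mult Ck_flat Ck_const)

lemma ramp'_bounds: assumes "d > 0" shows "0 \<le> ramp' d x" "ramp' d x \<le> 1"
proof -
  show "0 \<le> ramp' d x" using assms by (auto simp: ramp'_def)
  have "(1 + d / x) * exp (- (d / x)) \<le> exp (d / x) * exp (- (d / x))"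
    by (intro mult_right_mono exp_ge_add_one_self) auto
  also have "\<dots> = 1" by (simp add: exp_minus)
  finally show "ramp' d x \<le> 1" by (auto simp: ramp'_def)
qed

lemma ramp_mono: assumes "d > 0" "x \<le> y" shows "ramp d x \<le> ramp d y"
  using DERIV_nonneg_imp_nondecreasing[of x y "ramp d"] ramp_deriv[OF assms(1)]
    ramp'_bounds(1)[OF assms(1)] assms(2) by blast

lemma ramp_nonpos: "d > 0 \<Longrightarrow> x \<le> 0 \<Longrightarrow> ramp d x = 0"
  by (auto simp: ramp_def flat_def zero_less_divide_iff)

lemma ramp_pos_eq: "d > 0 \<Longrightarrow> x > 0 \<Longrightarrow> ramp d x = x * exp (- (d / x))"
  by (auto simp: ramp_def flat_def zero_less_divide_iff)

section \<open>Hamiltonians without periodic orbits\<close>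

text \<open>A tent of height \<open>c\<close> over an interval of half-length just below \<open>r\<close> has slope just above \<open>c / r\<close>,
  so for \<open>c < r m\<close> its slope is below \<open>m\<close>. The ramp rounds the feet of the tent, and replacing
  \<open>\<bar>x\<bar>\<close> by \<open>\<surd>(x\<^sup>2 + d\<^sup>2)\<close> rounds its top; both are 1-Lipschitz, so the rounding costs nothing but a
  factor that tends to 1 as \<open>d\<close> tends to 0. Smoothness is stated for compositions, the form in which
  it is used.\<close>

lemma tent_exists:
  fixes c r m :: real
  assumes "0 < c" "0 < m" "c < r * m"
  obtains f f' r' where "r' < r" "f 0 = c" "\<And>x. (f has_real_derivative f' x) (at x)"
    "\<And>x. \<bar>f' x\<bar> < m" "\<And>x. r' \<le> \<bar>x\<bar> \<Longrightarrow> f x = 0" "\<And>x. 0 \<le> f x" "\<And>x. f x \<le> c"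
    "\<And>k (g :: 'a::euclidean_space \<Rightarrow> real). Ck k g \<Longrightarrow> Ck k (\<lambda>x. f (g x))"
proof -
  \<comment> \<open>any half-length strictly between \<open>c / m\<close> and \<open>r\<close> leaves room for the rounding\<close>
  define r' where "r' = (r + c / m) / 2"
  have r': "c / m < r'" "r' < r" "0 < c / m"
    using assms by (auto simp: r'_def field_simps)
  have "((\<lambda>d. (r' - d) * exp (- (d / (r' - d)))) \<longlongrightarrow> (r' - 0) * exp (- (0 / (r' - 0)))) (at_right 0)"
    by (intro tendsto_intros) (use r' in auto)
  then have "((\<lambda>d. (r' - d) * exp (- (d / (r' - d)))) \<longlongrightarrow> r') (at_right 0)" by simp
  then have "\<forall>\<^sub>F d in at_right 0. c / m < (r' - d) * exp (- (d / (r' - d)))"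
    using r'(1) by (rule order_tendstoD)
  moreover have "\<forall>\<^sub>F d in at_right 0. d < r'" "\<forall>\<^sub>F d::real in at_right 0. 0 < d"
    using r' by (auto intro: eventually_at_right_less order_tendstoD(2)[OF tendsto_ident_at])
  ultimately have "\<forall>\<^sub>F d in at_right 0. 0 < d \<and> d < r' \<and> c / m < (r' - d) * exp (- (d / (r' - d)))"
    by eventually_elim auto
  then obtain d where d: "0 < d" "d < r'" "c / m < (r' - d) * exp (- (d / (r' - d)))"
    using eventually_happens'[of "at_right (0::real)"] by (auto simp: trivial_limit_at_right_real)
  define A where "A = ramp d (r' - d)"
  have A: "c / m < A" "0 < A" using d r' by (auto simp: A_def ramp_pos_eq)
  define L where "L x = (x ^ 2 + d ^ 2) powr (1 / 2)" for x :: real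
  have Lsqrt: "L x = sqrt (x ^ 2 + d ^ 2)" for x by (simp add: L_def powr_half_sqrt)
  have pos: "x ^ 2 + d ^ 2 > 0" for x :: real using d(1) by (simp add: add_nonneg_pos)
  have Lge: "\<bar>x\<bar> \<le> L x" "d \<le> L x" for x
    unfolding Lsqrt using d(1) by (auto intro!: real_le_rsqrt simp: power2_abs)
  have L': "(L has_real_derivative x / L x) (at x)" for x
    unfolding Lsqrt[abs_def] using pos[of x]
    by (auto intro!: derivative_eq_intros simp: divide_simps)
  define f where "f x = c / A * ramp d (r' - L x)" for x
  define f' where "f' x = c / A * (ramp' d (r' - L x) * - (x / L x))" for x
  have fd: "(f has_real_derivative f' x) (at x)" for x
    unfolding f_def[abs_def] f'_def
    by (rule DERIV_cmult, rule DERIV_chain2[OF ramp_deriv[OF d(1)]])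
      (auto intro!: derivative_eq_intros L')
  have cA: "0 < c / A" "c / A < m" using A assms by (auto simp: field_simps)
  show ?thesis
  proof
    show "r' < r" by fact
    show "f 0 = c" using A d(1) by (simp add: f_def Lsqrt A_def[symmetric])
    show "(f has_real_derivative f' x) (at x)" for x by (rule fd)
    show "\<bar>f' x\<bar> < m" for x
    proof -
      have "\<bar>ramp' d (r' - L x)\<bar> \<le> 1" using ramp'_bounds[OF d(1), of "r' - L x"] by auto
      moreover have "\<bar>x / L x\<bar> \<le> 1" using Lge[of x] d(1) by (simp add: field_simps)
      ultimately have "\<bar>ramp' d (r' - L x) * - (x / L x)\<bar> \<le> 1 * 1"
        unfolding abs_mult by (intro mult_mono) auto
      then have "\<bar>f' x\<bar> \<le> c / A * 1"
        unfolding f'_def abs_mult using cA by (intro mult_mono) (auto simp: abs_mult)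
      then show ?thesis using cA by simp
    qed
    show "f x = 0" if "r' \<le> \<bar>x\<bar>" for x
      using ramp_nonpos[OF d(1), of "r' - L x"] that Lge(1)[of x] by (auto simp: f_def)
    show "0 \<le> f x" for x
    proof -
      have "0 \<le> ramp d (r' - L x)"
        using ramp_mono[OF d(1), of "min 0 (r' - L x)" "r' - L x"] ramp_nonpos[OF d(1), of "min 0 (r' - L x)"]
        by simp
      then show ?thesis unfolding f_def using cA by (intro mult_nonneg_nonneg) auto
    qed
    show "f x \<le> c" for x
    proof -
      have "ramp d (r' - L x) \<le> A"
        unfolding A_def using Lge(2)[of x] by (intro ramp_mono d(1)) auto
      then have "c / A * ramp d (r' - L x) \<le> c / A * A" using cA by (intro mult_left_mono) auto
      then show ?thesis using A by (simp add: f_def)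
    qed
    show "Ck k (\<lambda>x. f (g x))" if "Ck k g" for k and g :: "'a \<Rightarrow> real"
      unfolding f_def L_def
      by (intro Ck_mult Ck_ramp Ck_diff Ck_const Ck_powr Ck_add pos)
        (use that in \<open>simp_all add: power2_eq_square Ck_mult Ck_const\<close>)
  qed
qed

text \<open>The mean value theorem for \<open>t \<mapsto> q(t) \<bullet> u\<close> over one period: somewhere the velocity, which is the
  gradient of \<open>h\<close>, must have the same component along \<open>u\<close> as the class of the loop.\<close>

lemma fibre_hamiltonian_no_orbit:
  fixes h :: "real^'n \<Rightarrow> real" and \<alpha> :: "int^'n"
  assumes h: "\<And>p. (h has_derivative h' p) (at p)"
    and small: "\<And>p. \<bar>h' p u\<bar> < \<bar>real_vec \<alpha> \<bullet> u\<bar>"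
  shows "periodic_orbits \<alpha> (\<lambda>(t, q, p). h p) = {}"
proof -
  have False if q: "\<And>t. q (t + 1) = q t + real_vec \<alpha>" and ham: "hamilton_eqs (\<lambda>(t, q, p). h p) q p" for q p
  proof -
    have "\<exists>q'. (q has_vector_derivative q') (at t) \<and> (h has_derivative (\<lambda>y. y \<bullet> q')) (at (p t))" for t
      using ham[unfolded hamilton_eqs_def, rule_format, of t] by (auto simp: pullback_def gderiv_def)
    then obtain q' where q': "\<And>t. (q has_vector_derivative q' t) (at t)"
      "\<And>t. (h has_derivative (\<lambda>y. y \<bullet> q' t)) (at (p t))" by metis
    have "((\<lambda>t. q t \<bullet> u) has_real_derivative q' t \<bullet> u) (at t)" for t
      using bounded_linear.has_vector_derivative[OF bounded_linear_inner_left q'(1)]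
      by (simp add: has_real_derivative_iff_has_vector_derivative)
    then have "\<exists>z>0::real. z < 1 \<and> q 1 \<bullet> u - q 0 \<bullet> u = (1 - 0) * (q' z \<bullet> u)"
      using MVT2[of 0 1 "\<lambda>t. q t \<bullet> u" "\<lambda>t. q' t \<bullet> u"] by auto
    moreover have "q 1 \<bullet> u - q 0 \<bullet> u = real_vec \<alpha> \<bullet> u"
      using q[of 0] by (simp add: inner_add_left)
    ultimately obtain z where "real_vec \<alpha> \<bullet> u = q' z \<bullet> u" by auto
    moreover have "h' (p z) = (\<lambda>y. y \<bullet> q' z)"
      using has_derivative_unique[OF h q'(2)] .
    ultimately show False using small[of "p z"] by (simp add: inner_commute)
  qed
  then show ?thesis by (auto simp: periodic_orbits_def)
qed

lemma compact_torus: "compact (UNIV :: ('n::finite) torus set)"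
proof -
  have "compact (fst ` (zero_section :: 'n cotangent set))"
    by (intro compact_continuous_image continuous_intros compact_zero_section)
  then show ?thesis by (simp add: zero_section_def)
qed

lemma continuous_on_circle_of: "continuous_on UNIV circle_of"
  by (simp add: continuous_on_open_vimage open_circle_def)

lemma circle_of_surj: "\<exists>y. x = circle_of y"
  using Quotient3_abs_rep[OF Quotient3_circle, of x] by metis

lemma compact_circle: "compact (UNIV :: circle set)"
proof -
  have "x \<in> circle_of ` {0..1}" for x :: circle
  proof -
    obtain y where y: "x = circle_of y" using circle_of_surj by blast
    have "circle_of y = circle_of (frac y)"
      unfolding circle.abs_eq_iff by (simp add: frac_def)
    moreover have "frac y \<in> {0..1}" by (simp add: less_imp_le[OF frac_lt_1])
    ultimately show ?thesis using y by blast
  qed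
  then have "(UNIV :: circle set) = circle_of ` {0..1}" by auto
  then show ?thesis
    by (metis compact_continuous_image compact_Icc continuous_on_circle_of continuous_on_subset subset_UNIV)
qed

lemma fibre_hamiltonian_in_BPS_class:
  fixes h :: "real^'n \<Rightarrow> real"
  assumes "norm v = 1" "\<And>k. Ck k (\<lambda>x :: real \<times> (real^'n) \<times> (real^'n). h (snd (snd x)))"
    "compact K" "\<And>p. h p \<noteq> 0 \<Longrightarrow> p \<in> K" "\<And>p. p \<in> K \<Longrightarrow> \<bar>p \<bullet> v\<bar> < r" "h 0 \<le> - c"
  shows "(\<lambda>(t, q, p). h p) \<in> BPS_class c (Y r v) zero_section"
proof -
  let ?H = "\<lambda>(t :: circle, q :: 'n torus, p). h p"
  let ?K = "UNIV \<times> UNIV \<times> K :: (circle \<times> 'n torus \<times> (real^'n)) set"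
  have sub: "{x. ?H x \<noteq> 0} \<subseteq> ?K" using assms(4) by auto
  have "closed ?K" using assms(3) by (intro closed_Times compact_imp_closed) auto
  then have cl: "closure {x. ?H x \<noteq> 0} \<subseteq> ?K" using sub by (simp add: closure_minimal)
  have "compact ?K" by (intro compact_Times compact_circle compact_torus assms(3))
  then have "compact (?K \<inter> closure {x. ?H x \<noteq> 0})" by (intro compact_Int_closed) auto
  then have "compact (closure {x. ?H x \<noteq> 0})" using cl by (simp add: Int_absorb1)
  moreover have "closure {x. ?H x \<noteq> 0} \<subseteq> UNIV \<times> Y r v"
    using cl assms(5) by (auto simp: Y_eq[OF assms(1)])
  moreover have "smooth (pullback ?H)"
    using assms(2) by (simp add: smooth_def pullback_def case_prod_unfold)
  moreover have "(SUP x\<in>UNIV \<times> zero_section. ereal (?H x)) \<le> ereal (- c)"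
    by (rule SUP_least) (use assms(6) in \<open>auto simp: zero_section_def\<close>)
  ultimately show ?thesis by (simp add: BPS_class_def compactly_supported_smooth_def)
qed

lemma C_BPS_geI:
  assumes "\<And>c. 0 < c \<Longrightarrow> ereal c < B \<Longrightarrow> \<exists>H\<in>BPS_class c W A. periodic_orbits \<alpha> H = {}"
  shows "B \<le> C_BPS W A \<alpha>"
  unfolding C_BPS_def
proof (rule Inf_greatest)
  fix x assume "x \<in> {ereal c |c. c > 0 \<and> (\<forall>H\<in>BPS_class c W A. periodic_orbits \<alpha> H \<noteq> {})}"
  then obtain c where "x = ereal c" "c > 0" "\<forall>H\<in>BPS_class c W A. periodic_orbits \<alpha> H \<noteq> {}"
    by auto
  then show "B \<le> x" using assms[of c] by (meson not_le)
qed

text \<open>The profile of the cutoff in the unbounded directions of the strip, as a function of the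
  squared distance from the axis \<open>\<real>v\<close>, so that no square root spoils smoothness.\<close>

lemma ramp1_cutoff:
  defines "g \<equiv> \<lambda>s :: real. ramp 1 (1 - s) / ramp 1 1"
  shows "g 0 = 1" "s \<ge> 0 \<Longrightarrow> 0 \<le> g s \<and> g s \<le> 1" "s \<ge> 1 \<Longrightarrow> g s = 0"
    "(g has_real_derivative - (ramp' 1 (1 - s) * exp 1)) (at s)" 
proof -
  have r1: "ramp 1 1 = exp (- 1)" by (simp add: ramp_pos_eq)
  show "g 0 = 1" "s \<ge> 1 \<Longrightarrow> g s = 0" by (auto simp: g_def r1 ramp_nonpos)
  show "0 \<le> g s \<and> g s \<le> 1" if "s \<ge> 0"
  proof -
    have "ramp 1 (1 - s) \<le> ramp 1 1" using that by (intro ramp_mono) auto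
    moreover have "0 \<le> ramp 1 (1 - s)"
      using ramp_mono[of 1 "min 0 (1 - s)" "1 - s"] ramp_nonpos[of 1 "min 0 (1 - s)"] by simp
    ultimately show ?thesis by (auto simp: g_def r1)
  qed
  have "((\<lambda>s. ramp 1 (1 - s)) has_real_derivative ramp' 1 (1 - s) * (0 - 1)) (at s)"
    by (rule DERIV_chain2[OF ramp_deriv]) (auto intro!: derivative_eq_intros)
  then show "(g has_real_derivative - (ramp' 1 (1 - s) * exp 1)) (at s)"
    unfolding g_def r1 by (rule DERIV_cong[OF DERIV_cdivide]) (simp add: exp_minus divide_inverse)
qed

lemma Ck_fibre_inner:
  "Ck k (\<lambda>x :: real \<times> ('a::euclidean_space) \<times> 'a. snd (snd x) \<bullet> w)"
  by (intro Ck_linear bounded_linear_compose[OF bounded_linear_inner_left]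
      bounded_linear_compose[OF bounded_linear_snd] bounded_linear_snd)

lemma Ck_fibre_square:
  "Ck k (\<lambda>x :: real \<times> ('a::euclidean_space) \<times> 'a. snd (snd x) \<bullet> snd (snd x))"
  by (subst euclidean_inner) (intro Ck_sum Ck_mult Ck_fibre_inner finite_Basis)

text \<open>The Hamiltonians behind both lower bounds: minus a tent in the coordinate along \<open>v\<close>, times a
  cutoff at distance \<open>R\<close> in the directions orthogonal to \<open>v\<close>. Along \<open>v\<close> only the tent is
  differentiated, so the slope is below \<open>m\<close>; across \<open>v\<close> only the cutoff is differentiated, and its
  slope decays like \<open>1 / R\<close>.\<close>

lemma strip_hamiltonian:
  fixes v :: "real^'n"
  assumes v: "norm v = 1" and c: "0 < c" "0 < m" "c < r * m" and R: "R > 0"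
  obtains h h' where "(\<lambda>(t, q, p). h p) \<in> BPS_class c (Y r v) zero_section"
    "\<And>p. (h has_derivative h' p) (at p)"
    "\<And>p. \<bar>h' p v\<bar> < m" "\<And>p u. orthogonal u v \<Longrightarrow> \<bar>h' p u\<bar> \<le> c * (exp 1 * 2 * norm u / R)"
proof -
  obtain f f' r' where f: "r' < r" "f 0 = c" "\<And>x. (f has_real_derivative f' x) (at x)"
    "\<And>x. \<bar>f' x\<bar> < m" "\<And>x. r' \<le> \<bar>x\<bar> \<Longrightarrow> f x = 0" "\<And>x. 0 \<le> f x" "\<And>x. f x \<le> c"
    "\<And>k (g :: real \<times> (real^'n) \<times> (real^'n) \<Rightarrow> real). Ck k g \<Longrightarrow> Ck k (\<lambda>x. f (g x))"
    using tent_exists[OF c] by metis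
  have vv: "v \<bullet> v = 1" using v by (simp add: norm_eq_1)
  define g where "g s = ramp 1 (1 - s) / ramp 1 1" for s :: real
  define g' where "g' s = - (ramp' 1 (1 - s) * exp 1)" for s :: real
  note g = ramp1_cutoff[folded g_def]
  have gd: "(g has_real_derivative g' s) (at s)" for s
    using g(4)[of s] by (simp add: g'_def g_def[abs_def])
  define S where "S p = (p \<bullet> p - (p \<bullet> v) * (p \<bullet> v)) * (1 / R ^ 2)" for p
  have S_eq: "S p = (norm (p - (p \<bullet> v) *\<^sub>R v))\<^sup>2 / R ^ 2" for p
    by (simp add: S_def power2_norm_eq_inner inner_diff_left inner_diff_right vv inner_commute)
  have S0: "S p \<ge> 0" for p unfolding S_eq by simp
  define h where "h p = - f (p \<bullet> v) * g (S p)" for p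
  define h' where "h' p y = - f (p \<bullet> v) * (g' (S p) * ((2 * (p \<bullet> y) - 2 * (p \<bullet> v) * (y \<bullet> v)) * (1 / R ^ 2)))
      + - (f' (p \<bullet> v) * (y \<bullet> v)) * g (S p)" for p y
  have S': "(S has_derivative (\<lambda>y. (2 * (p \<bullet> y) - 2 * (p \<bullet> v) * (y \<bullet> v)) * (1 / R ^ 2))) (at p)" for p
    unfolding S_def[abs_def]
    by (rule has_derivative_mult_left, rule has_derivative_eq_rhs, (rule derivative_intros)+)
      (simp add: fun_eq_iff inner_commute)
  have hd: "(h has_derivative h' p) (at p)" for p
  proof -
    have 1: "((\<lambda>p. f (p \<bullet> v)) has_derivative (\<lambda>y. f' (p \<bullet> v) * (y \<bullet> v))) (at p)"
      by (rule has_derivative_compose[OF _ f(3)[unfolded has_field_derivative_def]])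
        (auto intro!: derivative_eq_intros)
    have 2: "((\<lambda>p. g (S p)) has_derivative
        (\<lambda>y. g' (S p) * ((2 * (p \<bullet> y) - 2 * (p \<bullet> v) * (y \<bullet> v)) * (1 / R ^ 2)))) (at p)"
      by (rule has_derivative_compose[OF S' gd[unfolded has_field_derivative_def]])
    show ?thesis unfolding h_def[abs_def] h'_def[abs_def]
      by (rule has_derivative_mult[OF has_derivative_minus[OF 1] 2])
  qed
  have mem: "(\<lambda>(t, q, p). h p) \<in> BPS_class c (Y r v) zero_section"
  proof (rule fibre_hamiltonian_in_BPS_class[OF v])
    show "Ck k (\<lambda>x :: real \<times> (real^'n) \<times> (real^'n). h (snd (snd x)))" for k
    proof -
      have "h p = (- 1 * f (p \<bullet> v)) * ((1 / ramp 1 1) * ramp 1 (1 - S p))" for p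
        by (simp add: h_def g_def)
      then show ?thesis
        unfolding S_def
        by (simp only:) (intro Ck_mult Ck_const f(8) Ck_ramp Ck_diff Ck_fibre_inner Ck_fibre_square)
    qed
    let ?K = "{p. \<bar>p \<bullet> v\<bar> \<le> r'} \<inter> cball 0 (R + \<bar>r'\<bar>)"
    show "compact ?K"
      by (intro closed_Int_compact compact_cball closed_Collect_le continuous_intros)
    show "\<bar>p \<bullet> v\<bar> < r" if "p \<in> ?K" for p using that f(1) by auto
    show "h 0 \<le> - c" using g(1) f(2) by (simp add: h_def S_def)
    show "p \<in> ?K" if "h p \<noteq> 0" for p
    proof -
      have nz: "f (p \<bullet> v) \<noteq> 0" "g (S p) \<noteq> 0" using that by (auto simp: h_def)
      have 1: "\<bar>p \<bullet> v\<bar> < r'" using nz(1) f(5)[of "p \<bullet> v"] by (meson not_le)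
      have "S p < 1" using nz(2) g(3)[of "S p"] by (meson not_le)
      then have "(norm (p - (p \<bullet> v) *\<^sub>R v))\<^sup>2 < R ^ 2" using R by (simp add: S_eq)
      then have "norm (p - (p \<bullet> v) *\<^sub>R v) < R" using R by (simp add: power2_less_imp_less)
      moreover have "norm p \<le> norm (p - (p \<bullet> v) *\<^sub>R v) + norm ((p \<bullet> v) *\<^sub>R v)"
        by (metis diff_add_cancel norm_triangle_ineq)
      moreover have "norm ((p \<bullet> v) *\<^sub>R v) = \<bar>p \<bullet> v\<bar>" using v by simp
      ultimately have "norm p \<le> R + \<bar>r'\<bar>" using 1 by linarith
      then show ?thesis using 1 by simp
    qed
  qed
  show ?thesis
  proof (rule that[OF mem hd])
    show "\<bar>h' p v\<bar> < m" for p
    proof -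
      have "\<bar>f' (p \<bullet> v)\<bar> * \<bar>g (S p)\<bar> \<le> \<bar>f' (p \<bullet> v)\<bar> * 1"
        using g(2)[OF S0[of p]] by (intro mult_left_mono) auto
      then show ?thesis using f(4)[of "p \<bullet> v"] by (simp add: h'_def vv abs_mult)
    qed
    show "\<bar>h' p u\<bar> \<le> c * (exp 1 * 2 * norm u / R)" if "orthogonal u v" for p u
    proof -
      have uv: "u \<bullet> v = 0" using that by (simp add: orthogonal_def)
      have "\<bar>g' (S p) * ((2 * (p \<bullet> u)) * (1 / R ^ 2))\<bar> \<le> exp 1 * 2 * norm u / R"
      proof (cases "S p < 1")
        case True
        then have "(norm (p - (p \<bullet> v) *\<^sub>R v))\<^sup>2 < R ^ 2" using R by (simp add: S_eq)
        then have *: "norm (p - (p \<bullet> v) *\<^sub>R v) < R" using R by (simp add: power2_less_imp_less)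
        have "p \<bullet> u = (p - (p \<bullet> v) *\<^sub>R v) \<bullet> u" using uv by (simp add: inner_diff_left inner_commute[of v u])
        then have "\<bar>p \<bullet> u\<bar> \<le> norm (p - (p \<bullet> v) *\<^sub>R v) * norm u"
          by (metis Cauchy_Schwarz_ineq2)
        also have "\<dots> \<le> R * norm u" using * by (intro mult_right_mono) auto
        finally have pu: "\<bar>p \<bullet> u\<bar> \<le> R * norm u" .
        have "\<bar>g' (S p)\<bar> \<le> 1 * exp 1"
          using ramp'_bounds[of 1 "1 - S p"] by (simp add: g'_def abs_mult)
        then have "\<bar>g' (S p)\<bar> * (2 * \<bar>p \<bullet> u\<bar> / R ^ 2) \<le> exp 1 * (2 * (R * norm u) / R ^ 2)"
          using pu by (intro mult_mono divide_right_mono) auto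
        then show ?thesis using R by (simp add: abs_mult power2_eq_square field_simps)
      next
        case False
        then show ?thesis using R by (simp add: g'_def ramp'_def)
      qed
      then have "\<bar>f (p \<bullet> v)\<bar> * \<bar>g' (S p) * ((2 * (p \<bullet> u)) * (1 / R ^ 2))\<bar> \<le> c * (exp 1 * 2 * norm u / R)"
        using f(6,7)[of "p \<bullet> v"] by (intro mult_mono) auto
      then show ?thesis by (simp add: h'_def uv abs_mult)
    qed
  qed
qed

lemma C_BPS_ge:
  fixes v :: "real^'n"
  assumes v: "norm v = 1" and r: "r > 0" and \<alpha>: "\<bar>real_vec \<alpha> \<bullet> v\<bar> = m"
  shows "ereal (r * m) \<le> C_BPS (Y r v) zero_section \<alpha>"
proof (rule C_BPS_geI)
  fix c :: real assume c: "0 < c" "ereal c < ereal (r * m)"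
  then have "0 < r * m" by simp
  then have m: "m > 0" using r by (simp add: zero_less_mult_iff)
  obtain h h' where h: "(\<lambda>(t, q, p). h p) \<in> BPS_class c (Y r v) zero_section"
    "\<And>p. (h has_derivative h' p) (at p)" "\<And>p. \<bar>h' p v\<bar> < m"
    using strip_hamiltonian[OF v c(1) m, of r 1] c(2) by (metis less_ereal.simps(1) zero_less_one)
  have "periodic_orbits \<alpha> (\<lambda>(t, q, p). h p) = {}"
    by (rule fibre_hamiltonian_no_orbit[OF h(2), of v]) (use h(3) \<alpha> in auto)
  then show "\<exists>H\<in>BPS_class c (Y r v) zero_section. periodic_orbits \<alpha> H = {}" using h(1) by blast
qed

text \<open>Testing against the component \<open>u\<close> of the class orthogonal to \<open>v\<close>: the strip is unbounded in
  that direction, so a Hamiltonian of any depth can return to zero as slowly as desired.\<close>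

lemma C_BPS_infinite:
  fixes v :: "real^'n"
  assumes v: "norm v = 1" and r: "r > 0" and \<alpha>: "real_vec \<alpha> \<noteq> (real_vec \<alpha> \<bullet> v) *\<^sub>R v"
  shows "C_BPS (Y r v) zero_section \<alpha> = \<infinity>"
proof -
  have vv: "v \<bullet> v = 1" using v by (simp add: norm_eq_1)
  define u where "u = real_vec \<alpha> - (real_vec \<alpha> \<bullet> v) *\<^sub>R v"
  have u: "u \<noteq> 0" "orthogonal u v" using \<alpha> by (auto simp: u_def orthogonal_def inner_diff_left vv)
  have "real_vec \<alpha> \<bullet> u = u \<bullet> u"
  proof -
    have "real_vec \<alpha> = u + (real_vec \<alpha> \<bullet> v) *\<^sub>R v" by (simp add: u_def)
    then show ?thesis using u(2) by (metis add.right_neutral inner_add_left inner_commute inner_scaleR_left mult_zero_right orthogonal_def)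
  qed
  then have au: "real_vec \<alpha> \<bullet> u = norm u ^ 2" by (simp add: power2_norm_eq_inner)
  have "\<infinity> \<le> C_BPS (Y r v) zero_section \<alpha>"
  proof (rule C_BPS_geI)
    fix c :: real assume c: "0 < c"
    \<comment> \<open>any \<open>m > c / r\<close> admits a tent of height \<open>c\<close>; \<open>R\<close> makes the slope along \<open>u\<close> smaller than \<open>\<parallel>u\<parallel>\<^sup>2\<close>\<close>
    define m where "m = 2 * c / r"
    define R where "R = c * exp 1 * 2 / norm u + 1"
    have m: "m > 0" "c < r * m" using c r by (auto simp: m_def)
    have R: "R > 0" using c u by (auto simp: R_def intro!: add_nonneg_pos)
    obtain h h' where h: "(\<lambda>(t, q, p). h p) \<in> BPS_class c (Y r v) zero_section"
      "\<And>p. (h has_derivative h' p) (at p)"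
      "\<And>p u. orthogonal u v \<Longrightarrow> \<bar>h' p u\<bar> \<le> c * (exp 1 * 2 * norm u / R)"
      using strip_hamiltonian[OF v c m R] by metis
    have "c * (exp 1 * 2 * norm u / R) < norm u ^ 2"
    proof -
      have "c * exp 1 * 2 < norm u * R" using u(1) by (simp add: R_def field_simps)
      then have "c * exp 1 * 2 * norm u < norm u * R * norm u"
        by (rule mult_strict_right_mono) (use u(1) in simp)
      then have "c * exp 1 * 2 * norm u / R < norm u * norm u"
        using R by (simp add: pos_divide_less_eq mult_ac)
      then show ?thesis by (simp add: power2_eq_square mult_ac)
    qed
    then have "\<bar>h' p u\<bar> < \<bar>real_vec \<alpha> \<bullet> u\<bar>" for p using h(3)[OF u(2), of p] au by simp
    then have "periodic_orbits \<alpha> (\<lambda>(t, q, p). h p) = {}"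
      by (rule fibre_hamiltonian_no_orbit[OF h(2)])
    then show "\<exists>H\<in>BPS_class c (Y r v) zero_section. periodic_orbits \<alpha> H = {}" using h(1) by blast
  qed
  then show ?thesis by simp
qed

section \<open>The Poincare-Miranda theorem\<close>

lemma tendsto_fun_iff:
  fixes f :: "'c \<Rightarrow> 'i \<Rightarrow> 'b::topological_space"
  shows "(f \<longlongrightarrow> l) F \<longleftrightarrow> (\<forall>i. ((\<lambda>x. f x i) \<longlongrightarrow> l i) F)"
  using limitin_componentwise[of "\<lambda>i. euclidean" UNIV f l F]
  by (simp add: euclidean_product_topology)

lemma compact_Pi_cball:
  fixes b :: "'i \<Rightarrow> real"
  shows "compact {x :: 'i \<Rightarrow> 'b::euclidean_space. \<forall>i. norm (x i) \<le> b i}"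
proof -
  have "{x :: 'i \<Rightarrow> 'b. \<forall>i. norm (x i) \<le> b i} = PiE UNIV (\<lambda>i. cball 0 (b i))"
    by (auto simp: PiE_def Pi_def)
  then show ?thesis
    using compactin_PiE[of "\<lambda>i. euclidean :: 'b topology" UNIV "\<lambda>i. cball 0 (b i)"]
    by (simp add: euclidean_product_topology)
qed

text \<open>Cubes of every dimension are needed inside one argument, hence coordinates are functions
  and the dimension is a number instead of a type. Kuhn's combinatorial lemma, with the sign of
  the \<open>i\<close>-th component as the \<open>i\<close>-th label, yields for every mesh a small cell on which every component
  takes both signs; a limit of these cells is a common zero.\<close>

lemma Poincare_Miranda_nat:
  fixes f :: "(nat \<Rightarrow> real) \<Rightarrow> nat \<Rightarrow> real"
  assumes R: "R > 0" and cont: "\<And>i. i < n \<Longrightarrow> continuous_on UNIV (\<lambda>x. f x i)"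
    and lo: "\<And>x i. \<lbrakk>\<forall>j. \<bar>x j\<bar> \<le> R; i < n; x i = - R\<rbrakk> \<Longrightarrow> f x i \<le> 0"
    and hi: "\<And>x i. \<lbrakk>\<forall>j. \<bar>x j\<bar> \<le> R; i < n; x i = R\<rbrakk> \<Longrightarrow> 0 \<le> f x i"
  obtains x where "\<forall>j. \<bar>x j\<bar> \<le> R" "\<forall>i<n. f x i = 0"
proof -
  define pt where "pt p x j = (if j < n then - R + 2 * R * real (x j) / real p else 0)"
    for p :: nat and x :: "nat \<Rightarrow> nat" and j
  have pt_box: "\<bar>pt p x j\<bar> \<le> R" if "\<forall>i<n. x i \<le> p" "p > 0" for p x j
  proof (cases "j < n")
    case True
    then have "2 * R * (real (x j) / real p) \<le> 2 * R * 1"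
      using that R by (intro mult_left_mono) auto
    moreover have "0 \<le> 2 * R * (real (x j) / real p)" using R by simp
    ultimately show ?thesis using True by (simp add: pt_def)
  qed (use R in \<open>simp add: pt_def\<close>)
  have ex: "\<exists>c. (\<forall>j. \<bar>c j\<bar> \<le> R) \<and> (\<forall>i<n. \<exists>y z. (\<forall>j. \<bar>y j - c j\<bar> \<le> 2 * R / real p \<and> \<bar>z j - c j\<bar> \<le> 2 * R / real p)
      \<and> f y i \<le> 0 \<and> 0 \<le> f z i)" if p: "p > 0" for p
  proof -
    define label where "label x i = (if x i = 0 then 0 else if x i = p then 1
      else if f (pt p x) i < 0 then 0 else 1 :: nat)" for x i
    obtain q where q: "\<forall>i<n. q i < p"
      "\<forall>i<n. \<exists>r s. (\<forall>j<n. q j \<le> r j \<and> r j \<le> q j + 1) \<and> (\<forall>j<n. q j \<le> s j \<and> s j \<le> q j + 1) \<and> label r i \<noteq> label s i"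
      by (rule kuhn_lemma[of p n label]) (use p in \<open>auto simp: label_def\<close>)
    have lab01: "label x i = 0 \<or> label x i = 1" for x i by (simp add: label_def)
    have lab0: "f (pt p x) i \<le> 0" if "\<forall>i<n. x i \<le> p" "i < n" "label x i = 0" for x i
    proof (cases "x i = 0")
      case True
      show ?thesis
        by (rule lo) (use pt_box[OF that(1) p] that True in \<open>auto simp: pt_def\<close>)
    qed (use that in \<open>auto simp: label_def split: if_splits\<close>)
    have lab1: "0 \<le> f (pt p x) i" if "\<forall>i<n. x i \<le> p" "i < n" "label x i = 1" for x i
    proof (cases "x i = p")
      case True
      show ?thesis
        by (rule hi) (use pt_box[OF that(1) p] that True p in \<open>auto simp: pt_def\<close>)
    qed (use that in \<open>auto simp: label_def split: if_splits\<close>)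
    have near: "\<bar>pt p x j - pt p q j\<bar> \<le> 2 * R / real p" if "\<forall>j<n. q j \<le> x j \<and> x j \<le> q j + 1" for x j
    proof (cases "j < n")
      case True
      then have "pt p x j - pt p q j = 2 * R / real p * (real (x j) - real (q j))"
        by (simp add: pt_def right_diff_distrib diff_divide_distrib)
      moreover have "\<bar>real (x j) - real (q j)\<bar> \<le> 1" using that True by fastforce
      ultimately show ?thesis
        using R mult_left_mono[of "\<bar>real (x j) - real (q j)\<bar>" 1 "2 * R / real p"]
        by (simp add: abs_mult)
    qed (use R in \<open>simp add: pt_def\<close>)
    show ?thesis
    proof (rule exI[of _ "pt p q"], rule conjI, safe)
      show "\<bar>pt p q j\<bar> \<le> R" for j by (rule pt_box) (use q(1) p in auto)
    next
      fix i assume i: "i < n"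
      obtain r s where rs: "\<forall>j<n. q j \<le> r j \<and> r j \<le> q j + 1" "\<forall>j<n. q j \<le> s j \<and> s j \<le> q j + 1"
        "label r i \<noteq> label s i" using q(2) i by blast
      have le: "\<forall>i<n. r i \<le> p" "\<forall>i<n. s i \<le> p" using rs q(1) by fastforce+
      have "label r i = 0 \<and> label s i = 1 \<or> label s i = 0 \<and> label r i = 1"
        using rs(3) lab01 by metis
      then show "\<exists>y z. (\<forall>j. \<bar>y j - pt p q j\<bar> \<le> 2 * R / real p \<and> \<bar>z j - pt p q j\<bar> \<le> 2 * R / real p)
          \<and> f y i \<le> 0 \<and> 0 \<le> f z i"
      proof
        assume "label r i = 0 \<and> label s i = 1"
        then show ?thesis
          using lab0[OF le(1) i] lab1[OF le(2) i] near[OF rs(1)] near[OF rs(2)]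
          by (intro exI[of _ "pt p r"] exI[of _ "pt p s"]) simp
      next
        assume "label s i = 0 \<and> label r i = 1"
        then show ?thesis
          using lab0[OF le(2) i] lab1[OF le(1) i] near[OF rs(1)] near[OF rs(2)]
          by (intro exI[of _ "pt p s"] exI[of _ "pt p r"]) simp
      qed
    qed
  qed
  define W where "W p c i y z \<longleftrightarrow> (\<forall>j. \<bar>y j - c j\<bar> \<le> 2 * R / real (Suc p) \<and> \<bar>z j - c j\<bar> \<le> 2 * R / real (Suc p))
      \<and> f y i \<le> 0 \<and> 0 \<le> f z i" for p :: nat and c :: "nat \<Rightarrow> real" and i y z
  have "\<forall>p. \<exists>c. (\<forall>j. \<bar>c j\<bar> \<le> R) \<and> (\<forall>i<n. \<exists>y z. W p c i y z)"
    unfolding W_def by (intro allI ex zero_less_Suc)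
  then obtain c where c: "\<And>p j. \<bar>c p j\<bar> \<le> R" and yz: "\<And>p i. i < n \<Longrightarrow> \<exists>y z. W p (c p) i y z"
    by metis
  let ?K = "{x :: nat \<Rightarrow> real. \<forall>j. norm (x j) \<le> R}"
  have sc: "seq_compact ?K" by (intro compact_imp_seq_compact compact_Pi_cball)
  have cK: "\<forall>p. c p \<in> ?K" using c by simp
  obtain x \<phi> where x: "x \<in> ?K" "strict_mono (\<phi> :: nat \<Rightarrow> nat)" "(c \<circ> \<phi>) \<longlonglongrightarrow> x"
    by (rule seq_compactE[OF sc cK])
  have cx: "(\<lambda>p. c (\<phi> p) j) \<longlonglongrightarrow> x j" for j
    using x(3) unfolding tendsto_fun_iff by (simp add: o_def)
  have "(\<lambda>p. 2 * R / real (Suc p)) \<longlonglongrightarrow> 0"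
    using tendsto_mult[OF tendsto_const LIMSEQ_inverse_real_of_nat, of "2 * R"] by (simp add: divide_inverse)
  from LIMSEQ_subseq_LIMSEQ[OF this x(2)]
  have e0: "(\<lambda>p. 2 * R / real (Suc (\<phi> p))) \<longlonglongrightarrow> 0" by (simp only: o_def)
  have close: "y \<longlonglongrightarrow> x" if "\<And>p j. \<bar>y p j - c (\<phi> p) j\<bar> \<le> 2 * R / real (Suc (\<phi> p))" for y
  proof -
    have "(\<lambda>p. y p j - c (\<phi> p) j) \<longlonglongrightarrow> 0" for j
      by (rule Lim_null_comparison[OF _ e0]) (use that in auto)
    then have "(\<lambda>p. (y p j - c (\<phi> p) j) + c (\<phi> p) j) \<longlonglongrightarrow> 0 + x j" for j
      by (intro tendsto_add cx)
    then show ?thesis by (simp add: tendsto_fun_iff)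
  qed
  have "f x i = 0" if i: "i < n" for i
  proof -
    have "\<forall>p. \<exists>y z. W (\<phi> p) (c (\<phi> p)) i y z" using yz[OF i] by blast
    then obtain y z where W: "\<And>p. W (\<phi> p) (c (\<phi> p)) i (y p) (z p)" by metis
    have y: "\<bar>y p j - c (\<phi> p) j\<bar> \<le> 2 * R / real (Suc (\<phi> p))" "f (y p) i \<le> 0"
      and z: "\<bar>z p j - c (\<phi> p) j\<bar> \<le> 2 * R / real (Suc (\<phi> p))" "0 \<le> f (z p) i" for p j
      using W[of p] unfolding W_def by blast+
    have "isCont (\<lambda>x. f x i) x" using cont[OF i] by (simp add: continuous_on_eq_continuous_at)
    then have "(\<lambda>p. f (y p) i) \<longlonglongrightarrow> f x i" "(\<lambda>p. f (z p) i) \<longlonglongrightarrow> f x i"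
      using isCont_tendsto_compose[where g = "\<lambda>x. f x i", OF _ close] y(1) z(1) by blast+
    then have "f x i \<le> 0" "0 \<le> f x i"
      using y(2) z(2) by (meson LIMSEQ_le_const2 LIMSEQ_le_const)+
    then show ?thesis by simp
  qed
  moreover have "\<forall>j. \<bar>x j\<bar> \<le> R" using x(1) by simp
  ultimately show ?thesis using that by blast
qed

text \<open>Transport of the previous lemma along an enumeration of the index set.\<close>

theorem Poincare_Miranda:
  fixes f :: "('i \<Rightarrow> real) \<Rightarrow> 'i \<Rightarrow> real"
  assumes I: "finite I" and R: "R > 0" and cont: "\<And>i. i \<in> I \<Longrightarrow> continuous_on UNIV (\<lambda>x. f x i)"
    and lo: "\<And>x i. \<lbrakk>\<forall>j. \<bar>x j\<bar> \<le> R; i \<in> I; x i = - R\<rbrakk> \<Longrightarrow> f x i \<le> 0"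
    and hi: "\<And>x i. \<lbrakk>\<forall>j. \<bar>x j\<bar> \<le> R; i \<in> I; x i = R\<rbrakk> \<Longrightarrow> 0 \<le> f x i"
  obtains x where "\<forall>j. \<bar>x j\<bar> \<le> R" "\<forall>i\<in>I. f x i = 0"
proof -
  obtain h where h: "bij_betw h {0..<card I} I" using ex_bij_betw_nat_finite[OF I] by blast
  define k where "k = the_inv_into {0..<card I} h"
  have hk: "h (k i) = i" "k i < card I" if "i \<in> I" for i
    using h that f_the_inv_into_f[of h "{0..<card I}" i] the_inv_into_into[of h "{0..<card I}" i "{0..<card I}"]
    by (auto simp: k_def bij_betw_def)
  have kh: "k (h m) = m" "h m \<in> I" if "m < card I" for m
    using h that the_inv_into_f_f[of h "{0..<card I}" m] by (auto simp: k_def bij_betw_def)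
  define E where "E x i = (if i \<in> I then x (k i) else 0)" for x :: "nat \<Rightarrow> real" and i
  have E_box: "\<bar>E x i\<bar> \<le> R" if "\<forall>j. \<bar>x j\<bar> \<le> R" for x i using that R by (simp add: E_def)
  have "continuous_on UNIV (\<lambda>x. E x i)" for i unfolding E_def by (cases "i \<in> I") auto
  then have E_cont: "continuous_on UNIV E" by (rule continuous_on_coordinatewise_then_product)
  obtain x where x: "\<forall>j. \<bar>x j\<bar> \<le> R" "\<forall>m<card I. f (E x) (h m) = 0"
  proof (rule Poincare_Miranda_nat[OF R, of "card I" "\<lambda>x m. f (E x) (h m)"])
    show "continuous_on UNIV (\<lambda>x. f (E x) (h m))" if "m < card I" for m
      using continuous_on_compose2[OF cont[OF kh(2)[OF that]] E_cont] by simp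
  next
    fix x :: "nat \<Rightarrow> real" and m assume *: "\<forall>j. \<bar>x j\<bar> \<le> R" "m < card I"
    show "f (E x) (h m) \<le> 0" if "x m = - R"
      by (rule lo) (use * that E_box[OF *(1)] kh[OF *(2)] in \<open>auto simp: E_def\<close>)
    show "0 \<le> f (E x) (h m)" if "x m = R"
      by (rule hi) (use * that E_box[OF *(1)] kh[OF *(2)] in \<open>auto simp: E_def\<close>)
  qed
  have "\<forall>i\<in>I. f (E x) i = 0" using x(2) hk by metis
  then show ?thesis using that[of "E x"] E_box[OF x(1)] by blast
qed

section \<open>Almost critical points of the discrete action\<close>

text \<open>The time axis of a loop is divided into \<open>N\<close> steps, and \<open>G k\<close> is the Hamiltonian at time \<open>k / N\<close>,
  written in coordinates in which the position \<open>x\<^sub>k = q\<^sub>k - (k / N) \<alpha>\<close> of a loop of class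
  \<open>\<alpha> = lam v\<close> is cyclic. The Taylor estimate says that \<open>Gq\<close>, \<open>Gp\<close> are the partial gradients with
  quadratic control from one side, which is the side that gradient descent for the action needs.
  The linking takes place at the wall \<open>p \<bullet> v = r\<close>.\<close>

locale discrete_action =
  fixes N :: nat and G :: "nat \<Rightarrow> 'a::euclidean_space \<Rightarrow> 'a \<Rightarrow> real"
    and Gq Gp :: "nat \<Rightarrow> 'a \<Rightarrow> 'a \<Rightarrow> 'a" and v :: 'a and lam r \<epsilon> R0 M L c :: real
  assumes N: "N > 0"
    and Taylor: "\<And>k x p \<xi> \<eta>. G k x p + \<xi> \<bullet> Gq k x p + \<eta> \<bullet> Gp k x p - L * ((norm \<xi>)\<^sup>2 + (norm \<eta>)\<^sup>2)
        \<le> G k (x + \<xi>) (p + \<eta>)"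
    and G_cont: "\<And>k. continuous_on UNIV (\<lambda>w. G k (fst w) (snd w))"
    and Gq_cont: "\<And>k. continuous_on UNIV (\<lambda>w. Gq k (fst w) (snd w))"
    and Gp_cont: "\<And>k. continuous_on UNIV (\<lambda>w. Gp k (fst w) (snd w))"
    and G_bound: "\<And>k x p. \<bar>G k x p\<bar> \<le> M"
    and G_supp: "\<And>k x p. G k x p \<noteq> 0 \<Longrightarrow> norm p \<le> R0 \<and> p \<bullet> v \<le> r - \<epsilon>"
    and G_zero: "\<And>k x. G k x 0 \<le> - c"
    and v: "norm v = 1" and pos: "M > 0" "L \<ge> 0" "\<epsilon> > 0" "r > 0" "lam > 0" "R0 \<ge> 0"
    and level: "r * lam < c"
begin

definition h where "h = 1 / real N"

lemma h: "h > 0" "h \<le> 1" "real N * h = 1"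
  using N by (auto simp: h_def)

definition nxt where "nxt k = Suc k mod N"
definition prv where "prv k = (k + N - 1) mod N"

lemma nxt_lt: "nxt k < N" and prv_lt: "prv k < N"
  using N by (auto simp: nxt_def prv_def)

lemma prv_nxt: "k < N \<Longrightarrow> prv (nxt k) = k"
proof (cases "Suc k = N")
  case False
  assume "k < N"
  then have "Suc k < N" using False by simp
  then show ?thesis by (simp add: prv_def nxt_def)
qed (auto simp: prv_def nxt_def)

lemma nxt_prv: "k < N \<Longrightarrow> nxt (prv k) = k"
  by (cases k) (auto simp: prv_def nxt_def)

lemma sum_nxt: "(\<Sum>k<N. f k (nxt k)) = (\<Sum>k<N. f (prv k) k)"
  by (rule sum.reindex_bij_witness[where i = prv and j = nxt])
    (auto simp: nxt_lt prv_lt prv_nxt nxt_prv)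

type_synonym 'b config = "(nat \<Rightarrow> 'b) \<times> (nat \<Rightarrow> 'b)"

text \<open>The discretised action \<open>\<integral> p dq - H dt\<close>. The next two functions are its partial
  gradients; they vanish exactly on closed orbits of the symplectic Euler scheme.\<close>

definition act :: "'a config \<Rightarrow> real" where
  "act z = (\<Sum>k<N. snd z k \<bullet> ((h * lam) *\<^sub>R v + fst z (nxt k) - fst z k) - h * G k (fst z k) (snd z k))"

definition gradq :: "'a config \<Rightarrow> nat \<Rightarrow> 'a" where
  "gradq z k = snd z (prv k) - snd z k - h *\<^sub>R Gq k (fst z k) (snd z k)"

definition gradp :: "'a config \<Rightarrow> nat \<Rightarrow> 'a" where
  "gradp z k = (h * lam) *\<^sub>R v + fst z (nxt k) - fst z k - h *\<^sub>R Gp k (fst z k) (snd z k)"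

definition sqgrad :: "'a config \<Rightarrow> real" where
  "sqgrad z = (\<Sum>k<N. (norm (gradq z k))\<^sup>2 + (norm (gradp z k))\<^sup>2)"

text \<open>The bilinear part \<open>\<Sum> p\<^sub>k \<bullet> (x\<^sub>k\<^sub>+\<^sub>1 - x\<^sub>k)\<close> is expanded exactly, moving the difference from \<open>\<xi>\<close> to
  \<open>p\<close> by cyclic summation by parts; its second order term is bounded by the squared norms of the
  increments because a cyclic shift does not change a sum of squares.\<close>

lemma act_Taylor:
  "act (\<lambda>k. x k + \<xi> k, \<lambda>k. p k + \<eta> k) \<le> act (x, p)
    + (\<Sum>k<N. \<xi> k \<bullet> gradq (x, p) k + \<eta> k \<bullet> gradp (x, p) k)
    + (1 + L) * (\<Sum>k<N. (norm (\<xi> k))\<^sup>2 + (norm (\<eta> k))\<^sup>2)"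
proof -
  let ?b = "(h * lam) *\<^sub>R v"
  have "(p k + \<eta> k) \<bullet> (?b + (x (nxt k) + \<xi> (nxt k)) - (x k + \<xi> k)) - h * G k (x k + \<xi> k) (p k + \<eta> k)
    \<le> (p k \<bullet> (?b + x (nxt k) - x k) - h * G k (x k) (p k))
      + (\<xi> k \<bullet> (- p k - h *\<^sub>R Gq k (x k) (p k)) + \<eta> k \<bullet> gradp (x, p) k) + p k \<bullet> \<xi> (nxt k)
      + L * ((norm (\<xi> k))\<^sup>2 + (norm (\<eta> k))\<^sup>2) + (norm (\<eta> k))\<^sup>2 + ((norm (\<xi> k))\<^sup>2 + (norm (\<xi> (nxt k)))\<^sup>2) / 2"
    for k
  proof -
    have 1: "\<eta> k \<bullet> \<xi> (nxt k) \<le> ((norm (\<eta> k))\<^sup>2 + (norm (\<xi> (nxt k)))\<^sup>2) / 2"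
      using zero_le_power2[of "norm (\<eta> k - \<xi> (nxt k))"]
      unfolding power2_norm_eq_inner by (simp add: inner_diff_left inner_diff_right inner_commute)
    have 2: "- (\<eta> k \<bullet> \<xi> k) \<le> ((norm (\<eta> k))\<^sup>2 + (norm (\<xi> k))\<^sup>2) / 2"
      using zero_le_power2[of "norm (\<eta> k + \<xi> k)"]
      unfolding power2_norm_eq_inner by (simp add: inner_add_left inner_add_right inner_commute)
    let ?Q = "(norm (\<xi> k))\<^sup>2 + (norm (\<eta> k))\<^sup>2"
    have "h * (G k (x k) (p k) + \<xi> k \<bullet> Gq k (x k) (p k) + \<eta> k \<bullet> Gp k (x k) (p k) - L * ?Q)
        \<le> h * G k (x k + \<xi> k) (p k + \<eta> k)"
      using h by (intro mult_left_mono Taylor) auto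
    moreover have "h * (L * ?Q) \<le> 1 * (L * ?Q)" using h pos by (intro mult_right_mono) auto
    ultimately have 3: "- h * G k (x k + \<xi> k) (p k + \<eta> k) \<le> - (h * G k (x k) (p k))
        - h * (\<xi> k \<bullet> Gq k (x k) (p k)) - h * (\<eta> k \<bullet> Gp k (x k) (p k)) + L * ?Q"
      by (simp add: algebra_simps)
    show ?thesis
      using 1 2 3 unfolding gradp_def
      by (simp add: inner_add_left inner_add_right inner_diff_right inner_commute[of "p k" "\<xi> k"] field_simps)
  qed
  then have "act (\<lambda>k. x k + \<xi> k, \<lambda>k. p k + \<eta> k) \<le> (\<Sum>k<N. (p k \<bullet> (?b + x (nxt k) - x k) - h * G k (x k) (p k))
      + (\<xi> k \<bullet> (- p k - h *\<^sub>R Gq k (x k) (p k)) + \<eta> k \<bullet> gradp (x, p) k) + p k \<bullet> \<xi> (nxt k)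
      + L * ((norm (\<xi> k))\<^sup>2 + (norm (\<eta> k))\<^sup>2) + (norm (\<eta> k))\<^sup>2 + ((norm (\<xi> k))\<^sup>2 + (norm (\<xi> (nxt k)))\<^sup>2) / 2)"
    unfolding act_def by (intro sum_mono) simp
  also have "\<dots> = act (x, p) + (\<Sum>k<N. \<xi> k \<bullet> (- p k - h *\<^sub>R Gq k (x k) (p k)) + \<eta> k \<bullet> gradp (x, p) k)
      + (\<Sum>k<N. p k \<bullet> \<xi> (nxt k)) + L * (\<Sum>k<N. (norm (\<xi> k))\<^sup>2 + (norm (\<eta> k))\<^sup>2) + (\<Sum>k<N. (norm (\<eta> k))\<^sup>2)
      + ((\<Sum>k<N. (norm (\<xi> k))\<^sup>2) + (\<Sum>k<N. (norm (\<xi> (nxt k)))\<^sup>2)) / 2"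
    by (simp add: act_def sum.distrib sum_distrib_left sum_divide_distrib add_divide_distrib distrib_left)
  also have "(\<Sum>k<N. p k \<bullet> \<xi> (nxt k)) = (\<Sum>k<N. \<xi> k \<bullet> p (prv k))"
    using sum_nxt[of "\<lambda>i j. p i \<bullet> \<xi> j"] by (simp add: inner_commute)
  also have "(\<Sum>k<N. (norm (\<xi> (nxt k)))\<^sup>2) = (\<Sum>k<N. (norm (\<xi> k))\<^sup>2)"
    using sum_nxt[of "\<lambda>i j. (norm (\<xi> j))\<^sup>2"] .
  finally show ?thesis
    by (simp add: gradq_def sum.distrib inner_diff_right algebra_simps sum_subtractf sum_negf)
qed

text \<open>The level \<open>c'\<close> separates the action on the boundary of the linking disc (at most \<open>r lam\<close>) from the
  action on the zero section (at least \<open>c\<close>).\<close>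

definition c' where "c' = (r * lam + c) / 2"

lemma c': "r * lam < c'" "c' < c" using level by (simp_all add: c'_def mult.commute)

definition cutoff where "cutoff s = max 0 (min 1 ((s - c') / (c - c')))"

lemma cutoff: "0 \<le> cutoff s" "cutoff s \<le> 1" "s \<le> c' \<Longrightarrow> cutoff s = 0" "c \<le> s \<Longrightarrow> cutoff s = 1"
  using c' by (auto simp: cutoff_def divide_le_0_iff)

definition \<sigma> where "\<sigma> = 1 / (2 * (1 + L))"

lemma \<sigma>: "\<sigma> > 0" "(1 + L) * \<sigma> = 1 / 2" using pos by (auto simp: \<sigma>_def field_simps)

text \<open>One step of gradient descent, switched off below the level \<open>c'\<close>. The step size \<open>\<sigma>\<close> is chosen so
  that the second order term eats up at most half of the first order gain.\<close>

definition descend :: "'a config \<Rightarrow> 'a config" where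
  "descend z = (\<lambda>k. fst z k - (\<sigma> * cutoff (act z)) *\<^sub>R gradq z k, \<lambda>k. snd z k - (\<sigma> * cutoff (act z)) *\<^sub>R gradp z k)"

lemma sqgrad_nonneg: "sqgrad z \<ge> 0" by (simp add: sqgrad_def sum_nonneg)

lemma act_descend: "act (descend z) \<le> act z - \<sigma> * cutoff (act z) / 2 * sqgrad z"
proof -
  define s where "s = \<sigma> * cutoff (act z)"
  have s: "0 \<le> s" "s \<le> \<sigma>" using \<sigma> cutoff[of "act z"] by (auto simp: s_def mult_left_le)
  have "act (descend z) \<le> act z + (\<Sum>k<N. (- s *\<^sub>R gradq z k) \<bullet> gradq z k + (- s *\<^sub>R gradp z k) \<bullet> gradp z k)
      + (1 + L) * (\<Sum>k<N. (norm (- s *\<^sub>R gradq z k))\<^sup>2 + (norm (- s *\<^sub>R gradp z k))\<^sup>2)"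
    using act_Taylor[of "fst z" "\<lambda>k. - s *\<^sub>R gradq z k" "snd z" "\<lambda>k. - s *\<^sub>R gradp z k"]
    by (simp add: descend_def s_def)
  also have "\<dots> = act z - s * sqgrad z + (1 + L) * (s\<^sup>2 * sqgrad z)"
    by (simp add: sqgrad_def sum_distrib_left sum.distrib sum_negf sum_subtractf power_mult_distrib
        power2_norm_eq_inner distrib_left)
  also have "(1 + L) * (s\<^sup>2 * sqgrad z) \<le> (1 + L) * (s * \<sigma> * sqgrad z)"
    using s pos sqgrad_nonneg[of z] unfolding power2_eq_square
    by (intro mult_left_mono mult_right_mono) auto
  also have "(1 + L) * (s * \<sigma> * sqgrad z) = s * ((1 + L) * \<sigma>) * sqgrad z" by (simp add: mult_ac)
  finally show ?thesis unfolding \<sigma>(2) s_def by (simp add: mult_ac)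
qed

lemma act_descend_le: "act (descend z) \<le> act z"
  using act_descend[of z] cutoff(1)[of "act z"] \<sigma>(1) sqgrad_nonneg[of z]
  by (smt (verit) divide_nonneg_nonneg mult_nonneg_nonneg)

lemma descend_id: "act z \<le> c' \<Longrightarrow> descend z = z" by (simp add: descend_def cutoff)

lemma descend_pow_id: "act z \<le> c' \<Longrightarrow> (descend ^^ m) z = z" by (induction m) (auto simp: descend_id)

text \<open>Above the level \<open>c\<close> the cutoff equals 1, so every step makes its full gain.\<close>

lemma act_descend_pow:
  assumes "c \<le> act ((descend ^^ m) z)" "\<And>z. \<delta> \<le> sqgrad z"
  shows "act ((descend ^^ m) z) \<le> act z - real m * (\<sigma> / 2 * \<delta>)"
  using assms(1)
proof (induction m)
  case (Suc m)
  let ?w = "(descend ^^ m) z"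
  have w: "c \<le> act ?w" using Suc.prems act_descend_le[of ?w] by simp
  have "act (descend ?w) \<le> act ?w - \<sigma> / 2 * sqgrad ?w" using act_descend[of ?w] cutoff(4)[OF w] by simp
  moreover have "\<sigma> / 2 * \<delta> \<le> \<sigma> / 2 * sqgrad ?w" using \<sigma> assms(2) by (intro mult_left_mono) auto
  ultimately show ?case using Suc.IH[OF w] by (simp add: field_simps)
qed simp

lemma cont_comp:
  assumes "continuous_on S f" "continuous_on S g"
  shows "continuous_on S (\<lambda>z. G k (f z) (g z))" "continuous_on S (\<lambda>z. Gq k (f z) (g z))"
    "continuous_on S (\<lambda>z. Gp k (f z) (g z))"
  using continuous_on_compose2[OF G_cont continuous_on_Pair[OF assms], of k]
    continuous_on_compose2[OF Gq_cont continuous_on_Pair[OF assms], of k]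
    continuous_on_compose2[OF Gp_cont continuous_on_Pair[OF assms], of k] by auto

lemma coord_cont: "continuous_on S (\<lambda>z :: 'a config. fst z k)" "continuous_on S (\<lambda>z :: 'a config. snd z k)"
  by (rule continuous_on_product_then_coordinatewise, intro continuous_intros)+

lemma act_cont: "continuous_on S act"
  unfolding act_def[abs_def] by (intro continuous_intros cont_comp coord_cont)

lemma gradq_cont: "continuous_on S (\<lambda>z. gradq z k)"
  unfolding gradq_def[abs_def] by (intro continuous_intros cont_comp coord_cont)

lemma gradp_cont: "continuous_on S (\<lambda>z. gradp z k)"
  unfolding gradp_def[abs_def] by (intro continuous_intros cont_comp coord_cont)

lemma descend_cont: "continuous_on UNIV descend"
proof -
  have "continuous_on UNIV (\<lambda>z. cutoff (act z))"
    unfolding cutoff_def using c' by (intro continuous_intros act_cont) auto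
  then show ?thesis
    unfolding descend_def[abs_def]
    by (intro continuous_on_Pair continuous_on_coordinatewise_then_product continuous_intros
        coord_cont gradq_cont gradp_cont)
qed

lemma descend_pow_cont: "continuous_on UNIV (descend ^^ m)"
proof (induction m)
  case (Suc m)
  show ?case using continuous_on_compose2[OF descend_cont Suc.IH] by (simp add: o_def)
qed (simp add: id_def[symmetric])

text \<open>The linking disc is a graph over the momenta \<open>p\<close>: the positions \<open>X p\<close> are chosen with
  \<open>x\<^sub>k\<^sub>+\<^sub>1 - x\<^sub>k\<close> a negative multiple of \<open>p\<^sub>k - mean p\<close>, so that the bilinear part of the action is negative
  definite in the oscillation of \<open>p\<close>. The factor \<open>A\<close> is so large that, when the mean lies on the wall
  \<open>p \<bullet> v = r\<close>, this negative term outweighs \<open>- G\<close>, which is at most \<open>M\<close> and vanishes within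
  distance \<open>\<epsilon>\<close> of the wall.\<close>

definition A where "A = M / \<epsilon>\<^sup>2"

lemma A: "A > 0" "A * \<epsilon>\<^sup>2 = M" using pos by (auto simp: A_def)

definition mean :: "(nat \<Rightarrow> 'a) \<Rightarrow> 'a" where "mean p = h *\<^sub>R (\<Sum>k<N. p k)"

definition X :: "(nat \<Rightarrow> 'a) \<Rightarrow> nat \<Rightarrow> 'a" where
  "X p k = - (h * A) *\<^sub>R (\<Sum>j<k. p j - mean p)"

lemma sum_minus_mean: "(\<Sum>j<N. p j - mean p) = 0"
proof -
  have "(\<Sum>j<N. mean p) = (real N * h) *\<^sub>R (\<Sum>k<N. p k)" by (simp add: mean_def sum_constant_scaleR)
  then show ?thesis unfolding h(3) by (simp add: sum_subtractf)
qed

text \<open>The recursion also holds at the cyclic seam, since deviations from the mean add up to zero.\<close>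

lemma X_nxt:
  assumes "k < N" shows "X p (nxt k) - X p k = - (h * A) *\<^sub>R (p k - mean p)"
proof -
  have "X p (nxt k) = X p (Suc k)"
    by (cases "Suc k = N") (use assms sum_minus_mean[of p] in \<open>auto simp: nxt_def X_def\<close>)
  then show ?thesis by (simp add: X_def scaleR_right_distrib)
qed

lemma act_disc:
  "act (X p, p) = lam * (mean p \<bullet> v) + h * (\<Sum>k<N. - A * (norm (p k - mean p))\<^sup>2 - G k (X p k) (p k))"
proof -
  have "act (X p, p) = (\<Sum>k<N. (h * lam) * (p k \<bullet> v) - h * A * (p k \<bullet> (p k - mean p)) - h * G k (X p k) (p k))"
    unfolding act_def
  proof (rule sum.cong)
    fix k assume "k \<in> {..<N}"
    then have eq: "(h * lam) *\<^sub>R v + X p (nxt k) - X p k = (h * lam) *\<^sub>R v + - (h * A) *\<^sub>R (p k - mean p)"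
      using X_nxt[of k p] by (simp add: algebra_simps)
    then show "snd (X p, p) k \<bullet> ((h * lam) *\<^sub>R v + fst (X p, p) (nxt k) - fst (X p, p) k)
         - h * G k (fst (X p, p) k) (snd (X p, p) k)
       = (h * lam) * (p k \<bullet> v) - h * A * (p k \<bullet> (p k - mean p)) - h * G k (X p k) (p k)"
      unfolding fst_conv snd_conv eq by (simp add: inner_add_right inner_diff_right algebra_simps)
  qed simp
  also have "\<dots> = lam * (mean p \<bullet> v) - h * A * (\<Sum>k<N. p k \<bullet> (p k - mean p)) - h * (\<Sum>k<N. G k (X p k) (p k))"
    by (simp add: sum_subtractf sum_distrib_left mean_def inner_sum_left mult_ac)
  also have "(\<Sum>k<N. p k \<bullet> (p k - mean p)) = (\<Sum>k<N. (norm (p k - mean p))\<^sup>2) + mean p \<bullet> (\<Sum>k<N. p k - mean p)"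
    unfolding inner_sum_right sum.distrib[symmetric] power2_norm_eq_inner
    by (rule sum.cong) (auto simp: inner_diff_left)
  finally show ?thesis
    unfolding sum_minus_mean by (simp add: sum_subtractf sum_negf sum_distrib_left algebra_simps)
qed

lemma avg_le: "h * (\<Sum>k<N. f k) \<le> b" if "\<And>k. k < N \<Longrightarrow> f k \<le> b" for f :: "nat \<Rightarrow> real" and b
proof -
  have "h * (\<Sum>k<N. f k) \<le> h * (\<Sum>k<N. b)" using h that by (intro mult_left_mono sum_mono) auto
  also have "\<dots> = (real N * h) * b" by simp
  finally show ?thesis unfolding h(3) by simp
qed

lemma act_disc_upper:
  assumes "mean p \<bullet> v \<le> r" shows "act (X p, p) \<le> r * lam + M"
proof -
  have "h * (\<Sum>k<N. - A * (norm (p k - mean p))\<^sup>2 - G k (X p k) (p k)) \<le> M"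
  proof (rule avg_le)
    fix k
    have "0 \<le> A * (norm (p k - mean p))\<^sup>2" using A by simp
    then show "- A * (norm (p k - mean p))\<^sup>2 - G k (X p k) (p k) \<le> M"
      using G_bound[of k "X p k" "p k"] by linarith
  qed
  moreover have "lam * (mean p \<bullet> v) \<le> lam * r" using assms pos by (intro mult_left_mono) auto
  ultimately show ?thesis unfolding act_disc by (simp add: mult.commute)
qed

text \<open>On the boundary of the disc, either \<open>G\<close> vanishes at step \<open>k\<close> or \<open>p\<^sub>k\<close> has moved by \<open>\<epsilon>\<close> away from the
  mean; in the latter case the quadratic term compensates \<open>- G\<close>.\<close>

lemma act_disc_boundary:
  assumes "mean p \<bullet> v = r" shows "act (X p, p) \<le> r * lam"
proof -
  have "h * (\<Sum>k<N. - A * (norm (p k - mean p))\<^sup>2 - G k (X p k) (p k)) \<le> 0"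
  proof (rule avg_le)
    fix k
    show "- A * (norm (p k - mean p))\<^sup>2 - G k (X p k) (p k) \<le> 0"
    proof (cases "G k (X p k) (p k) = 0")
      case True
      then show ?thesis using A by simp
    next
      case False
      then have "\<epsilon> \<le> (mean p - p k) \<bullet> v"
        using G_supp[OF False] assms by (simp add: inner_diff_left)
      also have "\<dots> \<le> norm (p k - mean p)"
        using norm_cauchy_schwarz[of "mean p - p k" v] v by (simp add: norm_minus_commute)
      finally have "A * \<epsilon>\<^sup>2 \<le> A * (norm (p k - mean p))\<^sup>2"
        using A pos by (intro mult_left_mono power_mono) auto
      then show ?thesis unfolding A(2) using G_bound[of k "X p k" "p k"] by linarith
    qed
  qed
  then show ?thesis unfolding act_disc assms by (simp add: mult.commute)
qed

definition B where "B = R0 + 2 * sqrt (real N * M / A)"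

text \<open>The part of the disc above the level \<open>r lam\<close> is bounded: some \<open>p\<^sub>j\<close> must lie in the support of
  \<open>G\<close>, and the quadratic term keeps all other momenta near it.\<close>

lemma act_disc_bounded:
  assumes "mean p \<bullet> v \<le> r" "r * lam < act (X p, p)" "k < N"
  shows "norm (p k) \<le> B"
proof -
  let ?f = "\<lambda>k. - A * (norm (p k - mean p))\<^sup>2 - G k (X p k) (p k)"
  have "lam * (mean p \<bullet> v) \<le> lam * r" using assms pos by (intro mult_left_mono) auto
  then have pos_sum: "0 < h * (\<Sum>k<N. ?f k)"
    using assms(2) unfolding act_disc by (simp add: mult.commute)
  have "\<exists>k<N. G k (X p k) (p k) \<noteq> 0"
  proof (rule ccontr)
    assume "\<not> ?thesis"
    then have "h * (\<Sum>k<N. ?f k) \<le> 0" using A by (intro avg_le) auto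
    with pos_sum show False by simp
  qed
  then obtain j where j: "j < N" "norm (p j) \<le> R0" using G_supp by blast
  have dev: "norm (p i - mean p) \<le> sqrt (real N * M / A)" if "i < N" for i
  proof -
    have "(norm (p i - mean p))\<^sup>2 \<le> (\<Sum>k<N. (norm (p k - mean p))\<^sup>2)"
      by (rule member_le_sum) (use that in auto)
    then have "A * (norm (p i - mean p))\<^sup>2 \<le> A * (\<Sum>k<N. (norm (p k - mean p))\<^sup>2)"
      using A by (intro mult_left_mono) auto
    also have "\<dots> \<le> (\<Sum>k<N. - G k (X p k) (p k))"
    proof -
      have "0 < (\<Sum>k<N. ?f k)" using pos_sum h(1) by (simp add: zero_less_mult_iff)
      then show ?thesis by (simp add: sum_subtractf sum_negf sum_distrib_left)
    qed
    also have "\<dots> \<le> (\<Sum>k<N. M)"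
    proof (rule sum_mono)
      fix k show "- G k (X p k) (p k) \<le> M" using G_bound[of k "X p k" "p k"] by linarith
    qed
    finally have "(norm (p i - mean p))\<^sup>2 \<le> real N * M / A" using A by (simp add: field_simps)
    then show ?thesis by (rule real_le_rsqrt)
  qed
  have "norm (p k) = norm ((p k - mean p) - (p j - mean p) + p j)" by simp
  also have "\<dots> \<le> norm (p k - mean p) + norm (p j - mean p) + norm (p j)"
    by (meson norm_triangle_ineq norm_triangle_ineq4 add_right_mono order_trans)
  also have "\<dots> \<le> B" using dev[OF assms(3)] dev[OF j(1)] j(2) by (simp add: B_def)
  finally show ?thesis .
qed

text \<open>Retracts the space of momenta onto the half space \<open>mean p \<bullet> v \<le> r\<close> over which the disc lies, so
  that the degree argument can be made on a cube.\<close>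

definition clip :: "(nat \<Rightarrow> 'a) \<Rightarrow> nat \<Rightarrow> 'a" where
  "clip p k = p k - max 0 (mean p \<bullet> v - r) *\<^sub>R v"

lemma mean_clip: "mean (clip p) \<bullet> v = min (mean p \<bullet> v) r"
proof -
  have "mean (clip p) = mean p - (real N * h) *\<^sub>R (max 0 (mean p \<bullet> v - r) *\<^sub>R v)"
    by (simp add: mean_def clip_def sum_subtractf scaleR_right_diff_distrib sum_constant_scaleR mult_ac)
  moreover have "v \<bullet> v = 1" using v by (simp add: norm_eq_1)
  ultimately show ?thesis unfolding h(3) by (simp add: inner_diff_left)
qed

lemma clip_id: "mean p \<bullet> v \<le> r \<Longrightarrow> clip p = p" by (simp add: clip_def fun_eq_iff)

text \<open>However long the disc is pushed down, it still meets the zero section \<open>p = 0\<close>. The deformation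
  moves only points above the level \<open>c'\<close>; on the disc these are bounded and away from the
  boundary. Hence the map that adds to \<open>p\<close> the displacement of the momentum under the deformation
  fixes the faces of a large cube of momenta, and so has a zero; there the deformed disc meets the
  zero section.\<close>

lemma linking:
  obtains p where "mean p \<bullet> v \<le> r" "\<forall>k<N. snd ((descend ^^ m) (X p, p)) k = 0"
proof -
  define P :: "(nat \<times> 'a \<Rightarrow> real) \<Rightarrow> nat \<Rightarrow> 'a" where "P u k = (\<Sum>b\<in>Basis. u (k, b) *\<^sub>R b)" for u k
  have P_coord: "P u k \<bullet> b = u (k, b)" if "b \<in> Basis" for u k b
    using that by (simp add: P_def inner_sum_left inner_Basis if_distrib comm_monoid_add_class.sum.delta cong: if_cong)
  define D where "D u = (X (clip (P u)), clip (P u))" for u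
  define f where "f u i = u i + (snd ((descend ^^ m) (D u)) (fst i) - snd (D u) (fst i)) \<bullet> snd i" for u i
  have coord: "continuous_on UNIV (\<lambda>u :: nat \<times> 'a \<Rightarrow> real. u i)" for i by simp
  have P_cont: "continuous_on UNIV (\<lambda>u. P u k)" for k
    unfolding P_def by (intro continuous_intros coord)
  have clip_cont: "continuous_on UNIV (\<lambda>u. clip (P u) k)" for k
    unfolding clip_def mean_def by (intro continuous_intros P_cont)
  have D_cont: "continuous_on UNIV D"
    unfolding D_def X_def mean_def
    by (intro continuous_on_Pair continuous_on_coordinatewise_then_product continuous_intros clip_cont)
  have f_cont: "continuous_on UNIV (\<lambda>u. f u i)" for i
  proof -
    have "continuous_on UNIV (\<lambda>u. (descend ^^ m) (D u))"
      using continuous_on_compose2[OF descend_pow_cont D_cont] by simp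
    then have "continuous_on UNIV (\<lambda>u. snd ((descend ^^ m) (D u)) (fst i))"
      by (rule continuous_on_product_then_coordinatewise[OF continuous_on_snd])
    moreover have "continuous_on UNIV (\<lambda>u. snd (D u) (fst i))"
      by (simp add: D_def clip_cont)
    ultimately show ?thesis unfolding f_def by (intro continuous_intros coord)
  qed
  have fixed: "f u i = u i" if "act (D u) \<le> c'" for u i
    using that by (simp add: f_def descend_pow_id)
  have boundary: "f u i = u i" if i: "i \<in> {..<N} \<times> Basis" "\<bar>u i\<bar> = B + 1" for u i
  proof (rule fixed, rule ccontr)
    assume "\<not> act (D u) \<le> c'"
    then have big: "r * lam < act (D u)" using c' by simp
    have "mean (clip (P u)) \<bullet> v \<noteq> r"
      using act_disc_boundary[of "clip (P u)"] big by (auto simp: D_def)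
    then have "mean (P u) \<bullet> v \<le> r" unfolding mean_clip by (simp add: min_def split: if_splits)
    moreover from this have "norm (P u (fst i)) \<le> B"
      using act_disc_bounded[of "P u" "fst i"] big i by (auto simp: D_def clip_id)
    moreover have "\<bar>u i\<bar> \<le> norm (P u (fst i))"
      using P_coord[of "snd i" u "fst i"] i Basis_le_norm[of "snd i" "P u (fst i)"] by auto
    ultimately show False using that(2) by simp
  qed
  have B: "B + 1 > 0" using pos A by (simp add: B_def add_nonneg_pos)
  obtain u where u: "\<forall>i\<in>{..<N} \<times> Basis. f u i = 0"
  proof (rule Poincare_Miranda[of "{..<N} \<times> Basis" "B + 1" f])
    show "f u i \<le> 0" if "i \<in> {..<N} \<times> Basis" "u i = - (B + 1)" for u i
      using boundary[OF that(1), of u] that(2) B by simp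
    show "0 \<le> f u i" if "i \<in> {..<N} \<times> Basis" "u i = B + 1" for u i
      using boundary[OF that(1), of u] that(2) B by simp
  qed (use B f_cont in auto)
  have eq: "snd ((descend ^^ m) (D u)) k = clip (P u) k - P u k" if "k < N" for k
  proof (rule euclidean_eqI)
    fix b :: 'a assume b: "b \<in> Basis"
    have "f u (k, b) = 0" using u that b by blast
    then show "snd ((descend ^^ m) (D u)) k \<bullet> b = (clip (P u) k - P u k) \<bullet> b"
      using P_coord[OF b, of u k] by (simp add: f_def D_def inner_diff_left)
  qed
  have le: "mean (P u) \<bullet> v \<le> r"
  proof (rule ccontr)
    assume "\<not> ?thesis"
    then have "mean (clip (P u)) \<bullet> v = r" unfolding mean_clip by simp
    then have "act (D u) \<le> c'" using act_disc_boundary[of "clip (P u)"] c' by (simp add: D_def)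
    then have "(descend ^^ m) (D u) = D u" by (rule descend_pow_id)
    then have "P u k = 0" if "k < N" for k using eq[OF that] by (simp add: D_def)
    then have "mean (P u) = 0" by (simp add: mean_def)
    then show False using \<open>\<not> mean (P u) \<bullet> v \<le> r\<close> pos by simp
  qed
  show ?thesis
    by (rule that[OF le]) (use eq clip_id[OF le] in \<open>simp add: D_def\<close>)
qed

text \<open>If the gradient were bounded away from zero, the disc could be pushed below the level \<open>c\<close>, although
  a point of it must end on the zero section, where the action is at least \<open>c\<close>.\<close>

theorem almost_critical:
  assumes "\<delta> > 0" shows "\<exists>z. sqgrad z < \<delta>"
proof (rule ccontr)
  assume "\<nexists>z. sqgrad z < \<delta>"
  then have large: "\<delta> \<le> sqgrad z" for z by (meson not_less)
  obtain m :: nat where m: "r * lam + M - c < real m * (\<sigma> / 2 * \<delta>)"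
    using ex_less_of_nat_mult[of "\<sigma> / 2 * \<delta>" "r * lam + M - c"] \<sigma> assms by auto
  obtain p where p: "mean p \<bullet> v \<le> r" "\<forall>k<N. snd ((descend ^^ m) (X p, p)) k = 0" by (rule linking)
  let ?w = "(descend ^^ m) (X p, p)"
  have "c = h * (\<Sum>k<N. c)" using h(3) by (simp add: mult.commute)
  also have "\<dots> \<le> h * (\<Sum>k<N. - G k (fst ?w k) 0)"
  proof (intro mult_left_mono sum_mono)
    fix k show "c \<le> - G k (fst ?w k) 0" using G_zero[of k "fst ?w k"] by linarith
  qed (use h in auto)
  also have "\<dots> = act ?w" using p(2) by (simp add: act_def sum_distrib_left)
  finally have "c \<le> act ?w" .
  then have "c \<le> act (X p, p) - real m * (\<sigma> / 2 * \<delta>)"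
    using act_descend_pow[OF _ large] by fastforce
  then show False using act_disc_upper[OF p(1)] m by linarith
qed

end

section \<open>From the Euler scheme to the differential equation\<close>

text \<open>A sequence in a compact set need not have a convergent subsequence in a general space, but it
  converges along some finer filter, and that is enough to pass to the limit in inequalities.\<close>

lemma compact_cluster_filter:
  fixes W :: "nat \<Rightarrow> 'c::topological_space"
  assumes "compact S" "\<And>n. W n \<in> S"
  obtains l F where "F \<noteq> bot" "F \<le> sequentially" "(W \<longlongrightarrow> l) F"
proof -
  have "filtermap W sequentially \<noteq> bot" by (simp add: filtermap_bot_iff)
  moreover have "eventually (\<lambda>x. x \<in> S) (filtermap W sequentially)"
    using assms(2) by (simp add: eventually_filtermap)
  ultimately obtain l where l: "inf (nhds l) (filtermap W sequentially) \<noteq> bot"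
    using assms(1) unfolding compact_filter by meson
  define F where "F = inf (filtercomap W (nhds l)) sequentially"
  have "F \<noteq> bot"
  proof
    assume "F = bot"
    then have "eventually (\<lambda>_. False) F" by simp
    then obtain P Q where PQ: "eventually P (filtercomap W (nhds l))" "eventually Q sequentially"
      "\<And>x. P x \<and> Q x \<Longrightarrow> False"
      unfolding F_def eventually_inf by blast
    obtain P' where P': "eventually P' (nhds l)" "\<And>x. P' (W x) \<Longrightarrow> P x"
      using PQ(1) unfolding eventually_filtercomap by blast
    have "eventually (\<lambda>y. \<not> P' y) (filtermap W sequentially)"
      unfolding eventually_filtermap by (rule eventually_mono[OF PQ(2)]) (use PQ(3) P'(2) in blast)
    then have "eventually (\<lambda>_. False) (inf (nhds l) (filtermap W sequentially))"
      unfolding eventually_inf using P'(1) by blast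
    with l show False by (simp add: trivial_limit_def)
  qed
  moreover have "F \<le> sequentially" by (simp add: F_def)
  moreover have "(W \<longlongrightarrow> l) F"
    unfolding F_def by (rule tendsto_mono[OF inf_le1]) (simp add: filterlim_filtercomap)
  ultimately show ?thesis using that by blast
qed

text \<open>Almost-solutions of the Euler scheme with mesh \<open>1 / (n + 1)\<close> accumulate at a solution of the
  differential equation. They are regarded as step functions of time, points of a product of
  balls, one for each instant; this product is compact by Tychonoff's theorem. The limit is taken
  pointwise along a filter, in the estimate
  \<open>\<parallel>u(t) - u(s) - (t - s) V(s, u(s))\<parallel> \<le> K' (t - s)\<^sup>2\<close>, which contains the differential
  equation and involves two instants only.\<close>

lemma Euler_limit:
  fixes V :: "real \<Rightarrow> 'b::euclidean_space \<Rightarrow> 'b" and u :: "nat \<Rightarrow> int \<Rightarrow> 'b"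
  assumes Lip: "\<And>s t x y. norm (V s x - V t y) \<le> K * (\<bar>s - t\<bar> + norm (x - y))"
    and bd: "\<And>t x. norm (V t x) \<le> C" and K: "K \<ge> 0"
    and step: "\<And>n k. norm (u n (k + 1) - u n k - (1 / Suc n) *\<^sub>R V (k / Suc n) (u n k)) \<le> \<eta> n / Suc n"
    and \<eta>: "\<eta> \<longlonglongrightarrow> 0" "\<And>n. \<eta> n \<le> E"
    and start: "\<And>n. norm (u n 0) \<le> B"
    and shift: "\<And>n k. u n (k + int (Suc n)) = u n k + e"
  obtains l where "\<And>t. (l has_vector_derivative V t (l t)) (at t)" "\<And>t. l (t + 1) = l t + e"
proof -
  define h where "h n = 1 / real (Suc n)" for n
  have h: "0 < h n" "h n \<le> 1" "real (Suc n) * h n = 1" for n by (auto simp: h_def)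
  have step': "norm (u n (k + 1) - u n k - h n *\<^sub>R V (k * h n) (u n k)) \<le> h n * \<eta> n" for n k
    using step[where n = n and k = k] by (simp add: h_def)
  have \<eta>0: "0 \<le> \<eta> n" for n
  proof -
    have "0 \<le> h n * \<eta> n" using norm_ge_zero step'[of n 0] by (rule order_trans)
    then show ?thesis using h(1)[of n] by (simp add: zero_le_mult_iff)
  qed
  define D where "D = C + E"
  have C: "0 \<le> C" using bd[of 0 0] norm_ge_zero order_trans by blast
  have E: "0 \<le> E" using \<eta>0[of 0] \<eta>(2)[of 0] by simp
  have D: "0 \<le> D" using C E by (simp add: D_def)
  have one: "norm (u n (k + 1) - u n k) \<le> D * h n" for n k
  proof -
    have "norm (u n (k + 1) - u n k) \<le> norm (u n (k + 1) - u n k - h n *\<^sub>R V (k * h n) (u n k)) + norm (h n *\<^sub>R V (k * h n) (u n k))"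
      by (metis diff_add_cancel norm_triangle_ineq)
    also have "\<dots> \<le> h n * \<eta> n + h n * C"
      using step'[of n k] h(1)[of n] bd[of "k * h n" "u n k"] by (intro add_mono) (auto intro: mult_left_mono)
    also have "\<dots> = h n * (\<eta> n + C)" by (simp add: distrib_left)
    also have "\<dots> \<le> h n * D"
      using h(1)[of n] \<eta>(2)[of n] by (intro mult_left_mono) (auto simp: D_def)
    finally show ?thesis by (simp add: mult.commute)
  qed
  have many: "norm (u n (i + int d) - u n i) \<le> D * (h n * d)" for n i and d :: nat
  proof (induction d)
    case (Suc d)
    have "u n (i + int (Suc d)) - u n i = (u n (i + int d + 1) - u n (i + int d)) + (u n (i + int d) - u n i)"
      by (simp add: algebra_simps)
    then have "norm (u n (i + int (Suc d)) - u n i) \<le> D * h n + D * (h n * d)"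
      using one[of n "i + int d"] Suc by (metis add_mono norm_triangle_le)
    then show ?case by (simp add: algebra_simps)
  qed simp
  define K' where "K' = K * (1 + D)"
  have K': "K' \<ge> 0" using K D by (simp add: K'_def)
  \<comment> \<open>\<open>V\<close> changes by at most \<open>K (1 + D)\<close> times the elapsed time along an Euler polygon\<close>
  have quad: "norm (u n (i + int d) - u n i - (h n * d) *\<^sub>R V (i * h n) (u n i)) \<le> K' * (h n * d)\<^sup>2 + (h n * d) * \<eta> n"
    for n i and d :: nat
  proof (induction d)
    case (Suc d)
    let ?j = "i + int d"
    have "u n (i + int (Suc d)) - u n i - (h n * Suc d) *\<^sub>R V (i * h n) (u n i)
      = (u n ?j - u n i - (h n * d) *\<^sub>R V (i * h n) (u n i))
        + (u n (?j + 1) - u n ?j - h n *\<^sub>R V (?j * h n) (u n ?j))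
        + h n *\<^sub>R (V (?j * h n) (u n ?j) - V (i * h n) (u n i))"
      by (simp add: algebra_simps)
    moreover have "norm (h n *\<^sub>R (V (?j * h n) (u n ?j) - V (i * h n) (u n i))) \<le> K' * (h n * (h n * d))"
    proof -
      have "norm (V (?j * h n) (u n ?j) - V (i * h n) (u n i)) \<le> K * (\<bar>?j * h n - i * h n\<bar> + norm (u n ?j - u n i))"
        by (rule Lip)
      also have "\<dots> \<le> K * (h n * d + D * (h n * d))"
        using many[of n i d] K h(1)[of n] by (intro mult_left_mono add_mono) (auto simp: algebra_simps)
      also have "\<dots> = K' * (h n * d)" by (simp add: K'_def algebra_simps)
      finally have "h n * norm (V (?j * h n) (u n ?j) - V (i * h n) (u n i)) \<le> h n * (K' * (h n * d))"
        using h(1)[of n] by (intro mult_left_mono) auto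
      then show ?thesis using h(1)[of n] by (simp add: mult_ac)
    qed
    ultimately have "norm (u n (i + int (Suc d)) - u n i - (h n * Suc d) *\<^sub>R V (i * h n) (u n i))
      \<le> (K' * (h n * d)\<^sup>2 + (h n * d) * \<eta> n) + h n * \<eta> n + K' * (h n * (h n * d))"
      using Suc.IH step'[of n ?j] by (metis add_mono norm_triangle_le)
    also have "\<dots> = K' * ((h n)\<^sup>2 * (real d ^ 2 + d)) + (h n * Suc d) * \<eta> n"
      by (simp add: algebra_simps power2_eq_square)
    also have "\<dots> \<le> K' * ((h n)\<^sup>2 * (real (Suc d) ^ 2)) + (h n * Suc d) * \<eta> n"
      using K' by (intro add_right_mono mult_left_mono) (auto simp: power2_eq_square algebra_simps)
    finally show ?case by (simp add: power_mult_distrib)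
  qed simp
  define fl where "fl n t = \<lfloor>t * real (Suc n)\<rfloor>" for n t
  define W where "W n t = u n (fl n t)" for n t
  have fl_diff: "\<bar>fl n t * h n - t\<bar> \<le> h n" for n t
  proof -
    have "h n * (t * real (Suc n)) = t * (real (Suc n) * h n)" by (simp only: mult_ac)
    then have "fl n t * h n - t = h n * (fl n t - t * real (Suc n))"
      unfolding h(3) right_diff_distrib by simp
    moreover have "\<bar>fl n t - t * real (Suc n)\<bar> \<le> 1" unfolding fl_def by linarith
    ultimately show ?thesis using h(1)[of n] by (simp add: abs_mult mult_left_le)
  qed
  have W_step: "norm (W n t - W n s) \<le> D * (h n * (fl n t - fl n s))"
    and W_quad: "norm (W n t - W n s - (h n * (fl n t - fl n s)) *\<^sub>R V (fl n s * h n) (W n s))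
      \<le> K' * (h n * (fl n t - fl n s))\<^sup>2 + (h n * (fl n t - fl n s)) * \<eta> n" if "s \<le> t" for n s t
  proof -
    have "fl n s \<le> fl n t" unfolding fl_def using that by (intro floor_mono mult_right_mono) auto
    then obtain d where d: "fl n t = fl n s + int d" using zle_iff_zadd by auto
    then have "real_of_int (fl n t) - real_of_int (fl n s) = real d" by simp
    then show "norm (W n t - W n s) \<le> D * (h n * (fl n t - fl n s))"
      "norm (W n t - W n s - (h n * (fl n t - fl n s)) *\<^sub>R V (fl n s * h n) (W n s))
      \<le> K' * (h n * (fl n t - fl n s))\<^sup>2 + (h n * (fl n t - fl n s)) * \<eta> n"
      using many[of n "fl n s" d] quad[of n "fl n s" d] by (simp_all add: W_def d)
  qed
  have W_bound: "norm (W n t) \<le> B + D * (\<bar>t\<bar> + 2)" for n t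
  proof -
    have W0: "norm (W n 0) \<le> B" using start[of n] by (simp add: W_def fl_def)
    have *: "\<bar>h n * (fl n t - fl n 0)\<bar> \<le> \<bar>t\<bar> + 2"
      using fl_diff[of n t] h(2)[of n] by (simp add: fl_def algebra_simps)
    have "norm (W n t - W n 0) \<le> D * \<bar>h n * (fl n t - fl n 0)\<bar>"
    proof (cases "0 \<le> t")
      case True
      have "D * (h n * (fl n t - fl n 0)) \<le> D * \<bar>h n * (fl n t - fl n 0)\<bar>" using D by (intro mult_left_mono) auto
      then show ?thesis using W_step[OF True, of n] by linarith
    next
      case False
      then have "norm (W n 0 - W n t) \<le> D * (h n * (fl n 0 - fl n t))" using W_step[of t 0 n] by simp
      also have "\<dots> \<le> D * \<bar>h n * (fl n t - fl n 0)\<bar>" using D by (intro mult_left_mono) (auto simp: algebra_simps)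
      finally show ?thesis by (simp add: norm_minus_commute)
    qed
    also have "\<dots> \<le> D * (\<bar>t\<bar> + 2)" using * D by (intro mult_left_mono)
    finally have "norm (W n t - W n 0) \<le> D * (\<bar>t\<bar> + 2)" .
    then show ?thesis using W0 norm_triangle_sub[of "W n t" "W n 0"] by linarith
  qed
  obtain l F where F: "F \<noteq> bot" "F \<le> sequentially" "(W \<longlongrightarrow> l) F"
    by (rule compact_cluster_filter[OF compact_Pi_cball, of W "\<lambda>t. B + D * (\<bar>t\<bar> + 2)"]) (use W_bound in auto)
  have Wl: "((\<lambda>n. W n t) \<longlongrightarrow> l t) F" for t using F(3) unfolding tendsto_fun_iff by blast
  have hlim: "(h \<longlongrightarrow> 0) F"
    using tendsto_mono[OF F(2) LIMSEQ_inverse_real_of_nat] by (simp add: h_def[abs_def] inverse_eq_divide)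
  have \<eta>lim: "(\<eta> \<longlongrightarrow> 0) F" using tendsto_mono[OF F(2) \<eta>(1)] .
  have fll: "((\<lambda>n. fl n t * h n) \<longlongrightarrow> t) F" for t
  proof -
    have "((\<lambda>n. fl n t * h n - t) \<longlongrightarrow> 0) F"
      by (rule Lim_null_comparison[OF _ hlim]) (use fl_diff in auto)
    then show ?thesis by (simp add: LIM_zero_iff)
  qed
  have dl: "((\<lambda>n. h n * (fl n t - fl n s)) \<longlongrightarrow> t - s) F" for s t
    using tendsto_diff[OF fll[of t] fll[of s]] by (simp add: algebra_simps)
  have Vl: "((\<lambda>n. V (fl n s * h n) (W n s)) \<longlongrightarrow> V s (l s)) F" for s
  proof -
    have "((\<lambda>n. K * (\<bar>fl n s * h n - s\<bar> + norm (W n s - l s))) \<longlongrightarrow> K * (\<bar>s - s\<bar> + norm (l s - l s))) F"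
      by (intro tendsto_intros fll Wl)
    then have lim: "((\<lambda>n. K * (\<bar>fl n s * h n - s\<bar> + norm (W n s - l s))) \<longlongrightarrow> 0) F" by simp
    have "((\<lambda>n. V (fl n s * h n) (W n s) - V s (l s)) \<longlongrightarrow> 0) F"
      by (rule Lim_null_comparison[OF always_eventually lim]) (intro allI Lip)
    then show ?thesis by (simp add: LIM_zero_iff)
  qed
  have l_step: "norm (l t - l s) \<le> D * (t - s)" if "s \<le> t" for s t
  proof (rule tendsto_le[OF F(1)])
    show "((\<lambda>n. norm (W n t - W n s)) \<longlongrightarrow> norm (l t - l s)) F" by (intro tendsto_intros Wl)
    show "((\<lambda>n. D * (h n * (fl n t - fl n s))) \<longlongrightarrow> D * (t - s)) F" by (intro tendsto_intros dl)
  qed (use W_step[OF that] in auto)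
  have l_quad: "norm (l t - l s - (t - s) *\<^sub>R V s (l s)) \<le> K' * (t - s)\<^sup>2" if "s \<le> t" for s t
  proof (rule tendsto_le[OF F(1)])
    show "((\<lambda>n. norm (W n t - W n s - (h n * (fl n t - fl n s)) *\<^sub>R V (fl n s * h n) (W n s)))
        \<longlongrightarrow> norm (l t - l s - (t - s) *\<^sub>R V s (l s))) F"
      by (intro tendsto_intros Wl dl Vl)
    have "((\<lambda>n. K' * (h n * (fl n t - fl n s))\<^sup>2 + (h n * (fl n t - fl n s)) * \<eta> n)
        \<longlongrightarrow> K' * (t - s)\<^sup>2 + (t - s) * 0) F"
      by (intro tendsto_intros dl \<eta>lim)
    then show "((\<lambda>n. K' * (h n * (fl n t - fl n s))\<^sup>2 + (h n * (fl n t - fl n s)) * \<eta> n)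
        \<longlongrightarrow> K' * (t - s)\<^sup>2) F" by simp
  qed (use W_quad[OF that] in auto)
  \<comment> \<open>for times before \<open>t\<close> the base point of the estimate is moved by the Lipschitz bound for \<open>V\<close>\<close>
  have both: "norm (l y - l t - (y - t) *\<^sub>R V t (l t)) \<le> 2 * K' * \<bar>y - t\<bar> * \<bar>y - t\<bar>" for y t
  proof (cases "t \<le> y")
    case True
    have "0 \<le> K' * (y - t)\<^sup>2" using K' by simp
    then show ?thesis using l_quad[OF True] True by (simp add: power2_eq_square)
  next
    case False
    then have le: "y \<le> t" by simp
    have "l y - l t - (y - t) *\<^sub>R V t (l t)
      = - (l t - l y - (t - y) *\<^sub>R V y (l y)) + (t - y) *\<^sub>R (V t (l t) - V y (l y))"
      by (simp add: algebra_simps)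
    moreover have "norm ((t - y) *\<^sub>R (V t (l t) - V y (l y))) \<le> K' * (t - y)\<^sup>2"
    proof -
      have "norm (V t (l t) - V y (l y)) \<le> K * (\<bar>t - y\<bar> + norm (l t - l y))" by (rule Lip)
      also have "\<dots> \<le> K * ((t - y) + D * (t - y))"
        using K l_step[OF le] le by (intro mult_left_mono add_mono) auto
      also have "\<dots> = K' * (t - y)" by (simp add: K'_def algebra_simps)
      finally have "(t - y) * norm (V t (l t) - V y (l y)) \<le> (t - y) * (K' * (t - y))"
        using le by (intro mult_left_mono) auto
      then show ?thesis using le by (simp add: power2_eq_square mult_ac)
    qed
    ultimately have "norm (l y - l t - (y - t) *\<^sub>R V t (l t)) \<le> K' * (t - y)\<^sup>2 + K' * (t - y)\<^sup>2"
      using l_quad[OF le] by (metis add_mono norm_minus_cancel norm_triangle_le)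
    then show ?thesis using le by (simp add: power2_eq_square)
  qed
  have "(l has_vector_derivative V t (l t)) (at t)" for t
    unfolding has_vector_derivative_def has_derivative_at_alt
  proof (intro conjI allI impI)
    show "bounded_linear (\<lambda>x. x *\<^sub>R V t (l t))" by (rule bounded_linear_scaleR_left)
    fix \<epsilon> :: real assume \<epsilon>: "0 < \<epsilon>"
    show "\<exists>d>0. \<forall>y. norm (y - t) < d \<longrightarrow> norm (l y - l t - (y - t) *\<^sub>R V t (l t)) \<le> \<epsilon> * norm (y - t)"
    proof (intro exI conjI allI impI)
      show "0 < \<epsilon> / (2 * K' + 1)" using \<epsilon> K' by (intro divide_pos_pos) auto
      fix y assume y: "norm (y - t) < \<epsilon> / (2 * K' + 1)"
      then have "\<bar>y - t\<bar> * (2 * K' + 1) < \<epsilon>" using K' by (simp add: pos_less_divide_eq)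
      then have "2 * K' * \<bar>y - t\<bar> \<le> \<epsilon>" by (simp add: algebra_simps)
      then have "2 * K' * \<bar>y - t\<bar> * \<bar>y - t\<bar> \<le> \<epsilon> * \<bar>y - t\<bar>" by (intro mult_right_mono) auto
      then show "norm (l y - l t - (y - t) *\<^sub>R V t (l t)) \<le> \<epsilon> * norm (y - t)"
        using both[of y t] by simp
    qed
  qed
  moreover have "l (t + 1) = l t + e" for t
  proof -
    have "fl n (t + 1) = fl n t + int (Suc n)" for n
    proof -
      have "(t + 1) * real (Suc n) = t * real (Suc n) + of_int (int (Suc n))" by (simp add: algebra_simps)
      then show ?thesis unfolding fl_def by (simp only: floor_add_int)
    qed
    then have "W n (t + 1) = W n t + e" for n unfolding W_def by (simp only: shift)
    then have "((\<lambda>n. W n t + e) \<longlongrightarrow> l (t + 1)) F" using Wl[of "t + 1"] by simp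
    moreover have "((\<lambda>n. W n t + e) \<longlongrightarrow> l t + e) F" by (intro tendsto_intros Wl)
    ultimately show ?thesis using tendsto_unique[OF F(1)] by blast
  qed
  ultimately show ?thesis using that by blast
qed

section \<open>Orbits of periodic Hamiltonians\<close>

lemma real_vec_simps:
  "real_vec (x + y) = real_vec x + real_vec y" "real_vec (x - y) = real_vec x - real_vec y"
  "real_vec (- x) = - real_vec x"
  "real_vec (\<chi> i. m * x $ i) = of_int m *\<^sub>R real_vec x"
  by (simp_all add: real_vec_def vec_eq_iff)

text \<open>A compactly supported Hamiltonian lifted to the universal cover; periodicity makes its bounds
  uniform.\<close>

locale torus_hamiltonian =
  fixes F :: "real \<Rightarrow> real^'n \<Rightarrow> real^'n \<Rightarrow> real" and Fq Fp :: "real \<Rightarrow> real^'n \<Rightarrow> real^'n \<Rightarrow> real^'n"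
    and M L K C R0 :: real
  assumes Taylor: "\<And>t x p \<xi> \<eta>. F t x p + \<xi> \<bullet> Fq t x p + \<eta> \<bullet> Fp t x p - L * ((norm \<xi>)\<^sup>2 + (norm \<eta>)\<^sup>2)
        \<le> F t (x + \<xi>) (p + \<eta>)"
    and F_cont: "\<And>t. continuous_on UNIV (\<lambda>w. F t (fst w) (snd w))"
    and F_bound: "\<And>t x p. \<bar>F t x p\<bar> \<le> M"
    and grad_Lip: "\<And>t x p s y p'. norm (Fq t x p - Fq s y p') \<le> K * (\<bar>t - s\<bar> + norm (x - y) + norm (p - p'))"
       "\<And>t x p s y p'. norm (Fp t x p - Fp s y p') \<le> K * (\<bar>t - s\<bar> + norm (x - y) + norm (p - p'))"
    and grad_bound: "\<And>t x p. norm (Fq t x p) \<le> C" "\<And>t x p. norm (Fp t x p) \<le> C"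
    and grad_per: "\<And>t x p m z. Fq (t + of_int m) (x + real_vec z) p = Fq t x p"
       "\<And>t x p m z. Fp (t + of_int m) (x + real_vec z) p = Fp t x p"
    and F_supp: "\<And>t x p. F t x p \<noteq> 0 \<Longrightarrow> norm p \<le> R0"
    and Fp_supp: "\<And>t x p. Fp t x p \<noteq> 0 \<Longrightarrow> norm p \<le> R0"
    and nonneg: "M > 0" "L \<ge> 0" "K \<ge> 0" "C \<ge> 0" "R0 \<ge> 0"
begin

lemma grad_cont:
  "continuous_on UNIV (\<lambda>w. Fq t (fst w) (snd w))" "continuous_on UNIV (\<lambda>w. Fp t (fst w) (snd w))"
proof -
  have "continuous_on UNIV f"
    if "\<And>w w'. norm (f w - f w') \<le> K * (norm (fst w - fst w') + norm (snd w - snd w'))"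
    for f :: "(real^'n) \<times> (real^'n) \<Rightarrow> real^'n"
    unfolding continuous_on_iff
  proof (intro ballI allI impI)
    fix w :: "(real^'n) \<times> (real^'n)" and e :: real assume e: "0 < e"
    show "\<exists>d>0. \<forall>w'\<in>UNIV. dist w' w < d \<longrightarrow> dist (f w') (f w) < e"
    proof (intro exI conjI ballI impI)
      show "0 < e / (2 * K + 1)" using e nonneg by (intro divide_pos_pos) auto
      fix w' assume "dist w' w < e / (2 * K + 1)"
      then have "norm (w' - w) * (2 * K + 1) < e" using nonneg by (simp add: pos_less_divide_eq dist_norm)
      moreover have "norm (fst w' - fst w) \<le> norm (w' - w)" "norm (snd w' - snd w) \<le> norm (w' - w)"
        using norm_fst_le[of "fst w' - fst w" "snd w' - snd w"] norm_snd_le[of "snd w' - snd w" "fst w' - fst w"]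
        by (simp_all add: minus_prod_def)
      then have "K * (norm (fst w' - fst w) + norm (snd w' - snd w)) \<le> K * (2 * norm (w' - w))"
        using nonneg by (intro mult_left_mono) auto
      moreover have "norm (w' - w) * (2 * K + 1) = K * (2 * norm (w' - w)) + norm (w' - w)"
        by (simp add: algebra_simps)
      ultimately have "norm (f w' - f w) < e"
        using that[of w' w] norm_ge_zero[of "w' - w"] by linarith
      then show "dist (f w') (f w) < e" by (simp add: dist_norm)
    qed
  qed
  from this[of "\<lambda>w. Fq t (fst w) (snd w)"] this[of "\<lambda>w. Fp t (fst w) (snd w)"]
  show "continuous_on UNIV (\<lambda>w. Fq t (fst w) (snd w))" "continuous_on UNIV (\<lambda>w. Fp t (fst w) (snd w))"
    using grad_Lip[of t _ _ t] by auto
qed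

definition ham_field :: "real \<Rightarrow> (real^'n) \<times> (real^'n) \<Rightarrow> (real^'n) \<times> (real^'n)" where
  "ham_field t w = (Fp t (fst w) (snd w), - Fq t (fst w) (snd w))"

text \<open>An almost critical point of the discrete action, read on the universal cover, is an almost closed
  orbit of the Euler scheme. The discrete equation for \<open>p\<close> evaluates the gradient at the later
  end of the step; moving it to the earlier end costs another error of order \<open>1 / N\<close>. The starting
  point is bounded: the position after a lattice translation, the momentum because a
  loop that avoids the support of the Hamiltonian moves too little to have class \<open>\<alpha>\<close>.\<close>

lemma approx_orbit:
  fixes v :: "real^'n" and \<alpha> :: "int^'n" and n :: nat
  assumes v: "norm v = 1" "real_vec \<alpha> = lam *\<^sub>R v" "lam > 0"
    and supp: "\<epsilon> > 0" "r > 0" "\<And>t x p. F t x p \<noteq> 0 \<Longrightarrow> p \<bullet> v \<le> r - \<epsilon>"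
    and zero: "\<And>t x. F t x 0 \<le> - c" "r * lam < c"
    and \<eta>: "0 < \<eta>" "\<eta> \<le> 1" "\<eta> < lam"
  shows "\<exists>u :: int \<Rightarrow> (real^'n) \<times> (real^'n).
    (\<forall>k. norm (u (k + 1) - u k - (1 / Suc n) *\<^sub>R ham_field (k / Suc n) (u k))
        \<le> (2 * \<eta> + K * (2 * C + 3) / Suc n) / Suc n) \<and>
    norm (u 0) \<le> real CARD('n) + (R0 + C + 1) \<and>
    (\<forall>k. u (k + int (Suc n)) = u k + (real_vec \<alpha>, 0))"
proof -
  define N where "N = Suc n"
  define h where "h = 1 / real N"
  have h: "0 < h" "h \<le> 1" "real N * h = 1" by (auto simp: h_def N_def)
  let ?a = "real_vec \<alpha>"
  define G where "G k x p = F (real k * h) (x + (real k * h) *\<^sub>R ?a) p" for k :: nat and x p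
  define Gq where "Gq k x p = Fq (real k * h) (x + (real k * h) *\<^sub>R ?a) p" for k :: nat and x p
  define Gp where "Gp k x p = Fp (real k * h) (x + (real k * h) *\<^sub>R ?a) p" for k :: nat and x p
  interpret D: discrete_action N G Gq Gp v lam r \<epsilon> R0 M L c
  proof
    show "N > 0" by (simp add: N_def)
    show "G k x p + \<xi> \<bullet> Gq k x p + \<eta> \<bullet> Gp k x p - L * ((norm \<xi>)\<^sup>2 + (norm \<eta>)\<^sup>2) \<le> G k (x + \<xi>) (p + \<eta>)"
      for k x p \<xi> \<eta>
      using Taylor[of "real k * h" "x + (real k * h) *\<^sub>R ?a" p \<xi> \<eta>]
      by (simp add: G_def Gq_def Gp_def add_ac)
    have sh: "continuous_on UNIV (\<lambda>w :: (real^'n) \<times> (real^'n). (fst w + s *\<^sub>R ?a, snd w))" for s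
      by (intro continuous_intros)
    show "continuous_on UNIV (\<lambda>w. G k (fst w) (snd w))" for k
      using continuous_on_compose2[OF F_cont sh] by (simp add: G_def)
    show "continuous_on UNIV (\<lambda>w. Gq k (fst w) (snd w))" for k
      using continuous_on_compose2[OF grad_cont(1) sh] by (simp add: Gq_def)
    show "continuous_on UNIV (\<lambda>w. Gp k (fst w) (snd w))" for k
      using continuous_on_compose2[OF grad_cont(2) sh] by (simp add: Gp_def)
    show "\<bar>G k x p\<bar> \<le> M" for k x p by (simp add: G_def F_bound)
    show "norm p \<le> R0 \<and> p \<bullet> v \<le> r - \<epsilon>" if "G k x p \<noteq> 0" for k x p
      using that F_supp supp(3) unfolding G_def by blast
    show "G k x 0 \<le> - c" for k x by (simp add: G_def zero)
  qed (use v supp zero nonneg in auto)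
  have Dh: "D.h = h" by (simp add: D.h_def h_def)
  have "(h * \<eta>)\<^sup>2 > 0" using h \<eta> by simp
  then obtain z where z: "D.sqgrad z < (h * \<eta>)\<^sup>2" using D.almost_critical by blast
  obtain x p where xp: "z = (x, p)" by (cases z)
  have small: "norm (D.gradq z k) \<le> h * \<eta>" "norm (D.gradp z k) \<le> h * \<eta>" if "k < N" for k
  proof -
    have "(norm (D.gradq z k))\<^sup>2 + (norm (D.gradp z k))\<^sup>2 \<le> D.sqgrad z"
      unfolding D.sqgrad_def by (rule member_le_sum) (use that in auto)
    then have "(norm (D.gradq z k))\<^sup>2 + (norm (D.gradp z k))\<^sup>2 \<le> (h * \<eta>)\<^sup>2" using z by simp
    then have "(norm (D.gradq z k))\<^sup>2 \<le> (h * \<eta>)\<^sup>2" "(norm (D.gradp z k))\<^sup>2 \<le> (h * \<eta>)\<^sup>2"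
      using zero_le_power2[of "norm (D.gradq z k)"] zero_le_power2[of "norm (D.gradp z k)"] by linarith+
    then show "norm (D.gradq z k) \<le> h * \<eta>" "norm (D.gradp z k) \<le> h * \<eta>"
      using h \<eta> by (auto intro: power2_le_imp_le)
  qed
  \<comment> \<open>\<open>kk k\<close> is the cyclic index of the integer time \<open>k\<close>; subtracting \<open>m\<close> brings \<open>q 0\<close> into the unit cube\<close>
  define m :: "int^'n" where "m = (\<chi> i. \<lfloor>x 0 $ i\<rfloor>)"
  define kk where "kk k = nat (k mod int N)" for k :: int
  have N0: "N > 0" by (simp add: N_def)
  have kk: "kk k < N" "int (kk k) = k mod int N" for k
    using N0 by (auto simp: kk_def nat_less_iff)
  have kk_nxt: "kk (k + 1) = D.nxt (kk k)" for k
  proof -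
    have "int (kk (k + 1)) = (k mod int N + 1) mod int N" by (simp add: kk mod_simps)
    also have "\<dots> = int (D.nxt (kk k))" by (simp add: D.nxt_def zmod_int kk add.commute)
    finally show ?thesis by simp
  qed
  define q where "q k = x (kk k) - real_vec m + (of_int k * h) *\<^sub>R ?a" for k :: int
  define P where "P k = p (kk k)" for k :: int
  have split: "real_of_int k * h = real (kk k) * h + of_int (k div int N)" for k
  proof -
    have "real_of_int k = of_int (int (kk k)) + of_int (k div int N) * of_int (int N)"
      unfolding of_int_add[symmetric] of_int_mult[symmetric] of_int_eq_iff kk by simp
    then have "real_of_int k * h = real (kk k) * h + of_int (k div int N) * (real N * h)"
      by (simp add: distrib_right)
    then show ?thesis unfolding h(3) by simp
  qed
  have qeq: "q k = x (kk k) + (real (kk k) * h) *\<^sub>R ?a + real_vec ((\<chi> i. (k div int N) * \<alpha> $ i) - m)" for k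
    unfolding q_def split real_vec_simps by (simp add: scaleR_add_left)
  have Geq: "Gq (kk k) (x (kk k)) (p (kk k)) = Fq (of_int k * h) (q k) (P k)"
    "Gp (kk k) (x (kk k)) (p (kk k)) = Fp (of_int k * h) (q k) (P k)" for k
    unfolding Gq_def Gp_def P_def split qeq grad_per by simp_all
  have stepq: "q (k + 1) - q k - h *\<^sub>R Fp (of_int k * h) (q k) (P k) = D.gradp z (kk k)" for k
  proof -
    have "q (k + 1) - q k = h *\<^sub>R ?a + x (D.nxt (kk k)) - x (kk k)"
      unfolding q_def kk_nxt by (simp add: algebra_simps)
    then show ?thesis unfolding D.gradp_def xp Dh fst_conv snd_conv Geq[symmetric] v(2) by simp
  qed
  have stepp: "P (k + 1) - P k + h *\<^sub>R Fq (of_int (k + 1) * h) (q (k + 1)) (P (k + 1)) = - D.gradq z (kk (k + 1))" for k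
    unfolding D.gradq_def xp Dh fst_conv snd_conv Geq[symmetric] 
    by (simp add: P_def kk_nxt D.prv_nxt kk)
  have one: "norm (q (k + 1) - q k) \<le> h * (C + 1)" "norm (P (k + 1) - P k) \<le> h * (C + 1)" for k
  proof -
    have bd: "norm w \<le> h * (C + 1)" if "norm (w - h *\<^sub>R y) \<le> h * \<eta>" "norm y \<le> C" for w y :: "real^'n"
    proof -
      have "norm w \<le> norm (w - h *\<^sub>R y) + norm (h *\<^sub>R y)" by (metis diff_add_cancel norm_triangle_ineq)
      also have "\<dots> \<le> h * 1 + h * C"
        using that \<eta> h by (intro add_mono order_trans[OF that(1)]) (auto intro: mult_left_mono)
      finally show ?thesis by (simp add: algebra_simps)
    qed
    show "norm (q (k + 1) - q k) \<le> h * (C + 1)"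
      by (rule bd[of _ "Fp (of_int k * h) (q k) (P k)"])
        (use stepq[of k] small(2)[OF kk(1)] grad_bound(2) in auto)
    show "norm (P (k + 1) - P k) \<le> h * (C + 1)"
      by (rule bd[of _ "- Fq (of_int (k + 1) * h) (q (k + 1)) (P (k + 1))"])
        (use stepp[of k] small(1)[OF kk(1), of "k + 1"] grad_bound(1) in \<open>auto simp del: of_int_add\<close>)
  qed
  define u where "u k = (q k, P k)" for k
  have res: "norm (u (k + 1) - u k - h *\<^sub>R ham_field (k * h) (u k)) \<le> h * (2 * \<eta> + K * (2 * C + 3) * h)" for k
  proof -
    let ?e1 = "q (k + 1) - q k - h *\<^sub>R Fp (k * h) (q k) (P k)"
    let ?e2 = "P (k + 1) - P k + h *\<^sub>R Fq (k * h) (q k) (P k)"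
    let ?F0 = "Fq (k * h) (q k) (P k)" and ?F1 = "Fq (of_int (k + 1) * h) (q (k + 1)) (P (k + 1))"
    have "u (k + 1) - u k - h *\<^sub>R ham_field (k * h) (u k) = (?e1, ?e2)"
      by (simp add: u_def ham_field_def)
    then have "norm (u (k + 1) - u k - h *\<^sub>R ham_field (k * h) (u k)) \<le> norm ?e1 + norm ?e2"
      by (metis norm_Pair_le)
    moreover have "norm ?e1 \<le> h * \<eta>" unfolding stepq by (rule small(2)[OF kk(1)])
    moreover have "norm ?e2 \<le> h * \<eta> + h * (K * (2 * C + 3) * h)"
    proof -
      have "?e2 = - D.gradq z (kk (k + 1)) + h *\<^sub>R (?F0 - ?F1)"
        unfolding stepp[symmetric] by (simp add: scaleR_diff_right)
      then have "norm ?e2 \<le> norm (D.gradq z (kk (k + 1))) + norm (h *\<^sub>R (?F0 - ?F1))"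
        by (metis norm_minus_cancel norm_triangle_ineq)
      moreover have "norm (?F0 - ?F1) \<le> K * ((2 * C + 3) * h)"
      proof -
        have "norm (?F0 - ?F1) \<le> K * (\<bar>k * h - of_int (k + 1) * h\<bar> + norm (q k - q (k + 1)) + norm (P k - P (k + 1)))"
          by (rule grad_Lip)
        also have "\<dots> \<le> K * (h + h * (C + 1) + h * (C + 1))"
          using one[of k] nonneg h by (intro mult_left_mono add_mono) (auto simp: norm_minus_commute algebra_simps)
        finally show ?thesis by (simp add: algebra_simps)
      qed
      then have "h * norm (?F0 - ?F1) \<le> h * (K * (2 * C + 3) * h)"
        unfolding mult.assoc using h by (intro mult_left_mono) auto
      moreover have "norm (h *\<^sub>R (?F0 - ?F1)) = h * norm (?F0 - ?F1)" using h by simp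
      ultimately show ?thesis using small(1)[OF kk(1), of "k + 1"] by linarith
    qed
    ultimately show ?thesis by (simp add: algebra_simps)
  qed
  \<comment> \<open>otherwise the steps of the position would add up to less than \<open>lam\<close> instead of \<open>\<alpha>\<close>\<close>
  have "\<exists>j<N. Gp j (x j) (p j) \<noteq> 0"
  proof (rule ccontr)
    assume "\<not> ?thesis"
    then have "D.gradp z j = h *\<^sub>R ?a + x (D.nxt j) - x j" if "j < N" for j
      using that by (simp add: D.gradp_def xp Dh v(2))
    then have "(\<Sum>j<N. D.gradp z j) = (\<Sum>j<N. h *\<^sub>R ?a + x (D.nxt j) - x j)" by (intro sum.cong) auto
    also have "\<dots> = (real N * h) *\<^sub>R ?a + (\<Sum>j<N. x (D.nxt j)) - (\<Sum>j<N. x j)"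
      by (simp add: sum.distrib sum_subtractf sum_constant_scaleR mult.commute del: sum_constant)
    also have "(\<Sum>j<N. x (D.nxt j)) = (\<Sum>j<N. x j)"
      by (rule sum.reindex_bij_witness[where i = D.prv and j = D.nxt])
        (auto simp: D.nxt_lt D.prv_lt D.prv_nxt D.nxt_prv)
    finally have "?a = (\<Sum>j<N. D.gradp z j)" using h(3) by simp
    then have "norm ?a \<le> (\<Sum>j<N. norm (D.gradp z j))" by (metis norm_sum)
    also have "\<dots> \<le> (\<Sum>j<N. h * \<eta>)" using small(2) by (intro sum_mono) auto
    also have "\<dots> = (real N * h) * \<eta>" by simp
    finally show False using h(3) v \<eta> by simp
  qed
  then obtain j where j: "j < N" "norm (p j) \<le> R0" using Fp_supp unfolding Gp_def by blast
  have Pj: "norm (P (int i) - P 0) \<le> real i * (h * (C + 1))" for i :: nat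
  proof (induction i)
    case (Suc i)
    have "P (int (Suc i)) - P 0 = (P (int i + 1) - P (int i)) + (P (int i) - P 0)" by (simp add: add.commute)
    then have "norm (P (int (Suc i)) - P 0) \<le> h * (C + 1) + real i * (h * (C + 1))"
      using one(2)[of "int i"] Suc by (metis add_mono norm_triangle_le)
    then show ?case by (simp add: algebra_simps)
  qed simp
  have "P (int j) = p j" using j(1) by (simp add: P_def kk_def)
  then have "norm (P 0) \<le> norm (P (int j) - P 0) + R0"
    using j(2) norm_triangle_sub[of "P 0" "P (int j)"] by (simp add: norm_minus_commute)
  also have "norm (P (int j) - P 0) \<le> real j * (h * (C + 1))" by (rule Pj)
  also have "real j * (h * (C + 1)) \<le> real N * (h * (C + 1))"
    using j(1) h nonneg by (intro mult_right_mono) auto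
  also have "real N * (h * (C + 1)) = C + 1" unfolding mult.assoc[symmetric] h(3) by simp
  finally have P0: "norm (P 0) \<le> R0 + C + 1" by simp
  have q0: "norm (q 0) \<le> real CARD('n)"
  proof -
    have "norm (q 0) \<le> (\<Sum>i\<in>UNIV. \<bar>q 0 $ i\<bar>)" by (rule norm_le_l1_cart)
    also have "\<dots> \<le> (\<Sum>i\<in>(UNIV :: 'n set). 1)"
    proof (rule sum_mono)
      fix i
      have "q 0 $ i = frac (x 0 $ i)" by (simp add: q_def kk_def m_def real_vec_def frac_def)
      then show "\<bar>q 0 $ i\<bar> \<le> 1" using frac_ge_0 frac_lt_1 by (metis abs_of_nonneg less_imp_le)
    qed
    finally show ?thesis by simp
  qed
  show ?thesis
  proof (intro exI conjI allI)
    show "norm (u (k + 1) - u k - (1 / Suc n) *\<^sub>R ham_field (k / Suc n) (u k))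
        \<le> (2 * \<eta> + K * (2 * C + 3) / Suc n) / Suc n" for k
      using res[of k] by (simp add: h_def N_def)
    show "norm (u 0) \<le> real CARD('n) + (R0 + C + 1)"
      unfolding u_def using norm_Pair_le[of "q 0" "P 0"] q0 P0 by linarith
    show "u (k + int (Suc n)) = u k + (?a, 0)" for k
    proof -
      have "kk (k + int N) = kk k" by (simp add: kk_def)
      moreover have "real_of_int (k + int N) * h = of_int k * h + 1"
        using h(3) by (simp add: distrib_right)
      ultimately have "q (k + int N) = q k + ?a" "P (k + int N) = P k"
        unfolding q_def P_def by (simp_all add: scaleR_add_left)
      then show ?thesis unfolding u_def N_def[symmetric] by simp
    qed
  qed
qed

theorem orbit_exists:
  fixes v :: "real^'n" and \<alpha> :: "int^'n"
  assumes v: "norm v = 1" "real_vec \<alpha> = lam *\<^sub>R v" "lam > 0"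
    and supp: "\<epsilon> > 0" "r > 0" "\<And>t x p. F t x p \<noteq> 0 \<Longrightarrow> p \<bullet> v \<le> r - \<epsilon>"
    and zero: "\<And>t x. F t x 0 \<le> - c" "r * lam < c"
  obtains q p where "\<And>t. (q has_vector_derivative Fp t (q t) (p t)) (at t)"
    "\<And>t. (p has_vector_derivative - Fq t (q t) (p t)) (at t)"
    "\<And>t. q (t + 1) = q t + real_vec \<alpha>" "\<And>t. p (t + 1) = p t"
proof -
  define \<mu> where "\<mu> = min 1 (lam / 2)"
  define \<eta> where "\<eta> n = \<mu> / Suc n" for n
  have \<mu>: "0 < \<mu>" "\<mu> \<le> 1" "\<mu> < lam" using v by (auto simp: \<mu>_def)
  have \<eta>: "0 < \<eta> n" "\<eta> n \<le> \<mu>" for n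
    using \<mu> by (auto simp: \<eta>_def divide_le_eq mult_left_le)
  have "\<exists>u :: int \<Rightarrow> (real^'n) \<times> (real^'n).
    (\<forall>k. norm (u (k + 1) - u k - (1 / Suc n) *\<^sub>R ham_field (k / Suc n) (u k))
        \<le> (2 * \<eta> n + K * (2 * C + 3) / Suc n) / Suc n) \<and>
    norm (u 0) \<le> real CARD('n) + (R0 + C + 1) \<and>
    (\<forall>k. u (k + int (Suc n)) = u k + (real_vec \<alpha>, 0))" for n
    by (rule approx_orbit[OF v supp zero]) (use \<eta>[of n] \<mu> in auto)
  then obtain u :: "nat \<Rightarrow> int \<Rightarrow> (real^'n) \<times> (real^'n)"
    where u1: "\<And>n k. norm (u n (k + 1) - u n k - (1 / Suc n) *\<^sub>R ham_field (k / Suc n) (u n k))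
        \<le> (2 * \<eta> n + K * (2 * C + 3) / Suc n) / Suc n"
      and u2: "\<And>n. norm (u n 0) \<le> real CARD('n) + (R0 + C + 1)"
      and u3: "\<And>n k. u n (k + int (Suc n)) = u n k + (real_vec \<alpha>, 0)"
    by metis
  have V_Lip: "norm (ham_field s x - ham_field t y) \<le> (4 * K) * (\<bar>s - t\<bar> + norm (x - y))" for s t x y
  proof -
    have "norm (ham_field s x - ham_field t y) \<le> norm (Fp s (fst x) (snd x) - Fp t (fst y) (snd y))
        + norm (- (Fq s (fst x) (snd x) - Fq t (fst y) (snd y)))"
      unfolding ham_field_def using norm_Pair_le by simp
    also have "\<dots> \<le> K * (\<bar>s - t\<bar> + norm (fst x - fst y) + norm (snd x - snd y))
        + K * (\<bar>s - t\<bar> + norm (fst x - fst y) + norm (snd x - snd y))"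
      unfolding norm_minus_cancel by (intro add_mono grad_Lip)
    also have "\<dots> \<le> K * (\<bar>s - t\<bar> + norm (x - y) + norm (x - y)) + K * (\<bar>s - t\<bar> + norm (x - y) + norm (x - y))"
      using norm_fst_le[of "fst x - fst y" "snd x - snd y"] norm_snd_le[of "snd x - snd y" "fst x - fst y"] nonneg
      by (intro add_mono mult_left_mono) (auto simp: minus_prod_def)
    also have "\<dots> \<le> (4 * K) * (\<bar>s - t\<bar> + norm (x - y))" using nonneg by (simp add: algebra_simps)
    finally show ?thesis .
  qed
  have V_bd: "norm (ham_field t x) \<le> 2 * C" for t x
    unfolding ham_field_def using norm_Pair_le[of "Fp t (fst x) (snd x)" "- Fq t (fst x) (snd x)"]
      grad_bound[of t "fst x" "snd x"] by simp
  have "(\<lambda>n. 1 / real (Suc n)) \<longlonglongrightarrow> 0"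
    using LIMSEQ_inverse_real_of_nat by (simp add: inverse_eq_divide)
  then have "(\<lambda>n. (2 * \<mu> + K * (2 * C + 3)) * (1 / real (Suc n))) \<longlonglongrightarrow> (2 * \<mu> + K * (2 * C + 3)) * 0"
    by (intro tendsto_intros)
  then have lim: "(\<lambda>n. 2 * \<eta> n + K * (2 * C + 3) / Suc n) \<longlonglongrightarrow> 0"
    by (simp add: \<eta>_def add_divide_distrib)
  have ub: "2 * \<eta> n + K * (2 * C + 3) / Suc n \<le> 2 * \<mu> + K * (2 * C + 3)" for n
  proof -
    have "K * (2 * C + 3) / Suc n \<le> K * (2 * C + 3)"
      using nonneg mult_left_mono[of 1 "real (Suc n)" "K * (2 * C + 3)"] by (simp add: divide_le_eq)
    then show ?thesis using \<eta>[of n] by simp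
  qed
  have K4: "4 * K \<ge> 0" using nonneg by simp
  obtain l where l: "\<And>t. (l has_vector_derivative ham_field t (l t)) (at t)" "\<And>t. l (t + 1) = l t + (real_vec \<alpha>, 0)"
    by (rule Euler_limit[where V = ham_field and u = u, OF V_Lip V_bd K4 u1 lim ub u2 u3]) (rule that)
  show ?thesis
  proof (rule that[of "\<lambda>t. fst (l t)" "\<lambda>t. snd (l t)"])
    show "((\<lambda>t. fst (l t)) has_vector_derivative Fp t (fst (l t)) (snd (l t))) (at t)" for t
      using bounded_linear.has_vector_derivative[OF bounded_linear_fst l(1)] by (simp add: ham_field_def)
    show "((\<lambda>t. snd (l t)) has_vector_derivative - Fq t (fst (l t)) (snd (l t))) (at t)" for t
      using bounded_linear.has_vector_derivative[OF bounded_linear_snd l(1)] by (simp add: ham_field_def)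
  qed (simp_all add: l(2))
qed

end

section \<open>Compactly supported Hamiltonians on the cotangent bundle of the torus\<close>

definition lattice_periodic :: "(real \<times> (real^'n) \<times> (real^'n) \<Rightarrow> real) \<Rightarrow> bool" where
  "lattice_periodic f \<longleftrightarrow> (\<forall>x (m::int) z. f (x + (of_int m, real_vec z, 0)) = f x)"

definition fibre_support :: "real \<Rightarrow> (real \<times> (real^'n) \<times> (real^'n) \<Rightarrow> real) \<Rightarrow> bool" where
  "fibre_support R f \<longleftrightarrow> (\<forall>x. R < norm (snd (snd x)) \<longrightarrow> f x = 0)"

lemma Ck_differentiable: "Ck (Suc k) f \<Longrightarrow> f differentiable (at x)"
  by (simp only: Ck.simps)

lemma frechet_derivative_periodic:
  assumes "f differentiable (at (x + e))" "\<And>y. f (y + e) = f y"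
  shows "frechet_derivative f (at (x + e)) = frechet_derivative f (at x)"
proof -
  have "(f has_derivative frechet_derivative f (at (x + e))) (at (x + e))"
    using assms(1) by (simp add: frechet_derivative_works[symmetric])
  then have "((\<lambda>y. f (y + e)) has_derivative frechet_derivative f (at (x + e))) (at x)"
    using has_derivative_compose[of "\<lambda>y. y + e" "\<lambda>h. h" x UNIV f]
    by (simp add: has_derivative_add_const)
  then have "(f has_derivative frechet_derivative f (at (x + e))) (at x)" by (simp add: assms(2))
  then show ?thesis by (rule frechet_derivative_at)
qed

text \<open>Both properties pass to derivatives, so that boundedness of continuous functions gives
  boundedness of all derivatives.\<close>

lemma derivative_inherits:
  fixes f :: "real \<times> (real^'n) \<times> (real^'n) \<Rightarrow> real"
  assumes "\<And>x. f differentiable (at x)"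
  shows "lattice_periodic f \<Longrightarrow> lattice_periodic (\<lambda>x. frechet_derivative f (at x) w)"
    "fibre_support R f \<Longrightarrow> fibre_support R (\<lambda>x. frechet_derivative f (at x) w)"
proof -
  show "lattice_periodic (\<lambda>x. frechet_derivative f (at x) w)" if "lattice_periodic f"
    unfolding lattice_periodic_def
  proof (intro allI)
    fix x and m :: int and z
    have "frechet_derivative f (at (x + (of_int m, real_vec z, 0))) = frechet_derivative f (at x)"
      by (rule frechet_derivative_periodic[OF assms]) (use that in \<open>unfold lattice_periodic_def, blast\<close>)
    then show "frechet_derivative f (at (x + (of_int m, real_vec z, 0))) w = frechet_derivative f (at x) w"
      by simp
  qed
  show "fibre_support R (\<lambda>x. frechet_derivative f (at x) w)" if "fibre_support R f"
    unfolding fibre_support_def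
  proof (intro allI impI)
    fix x :: "real \<times> (real^'n) \<times> (real^'n)" assume x: "R < norm (snd (snd x))"
    have "open {x :: real \<times> (real^'n) \<times> (real^'n). R < norm (snd (snd x))}"
      by (intro open_Collect_less continuous_intros)
    then have "(f has_derivative (\<lambda>_. 0)) (at x)"
      by (rule has_derivative_transform_within_open[OF has_derivative_const[of 0]])
        (use x that in \<open>auto simp: fibre_support_def\<close>)
    then show "frechet_derivative f (at x) w = 0" by (metis frechet_derivative_at)
  qed
qed

text \<open>A lattice translation moves every point into the compact set \<open>[0, 1] \<times> [0, 1]\<^sup>n \<times> cball 0 R\<close>,
  unless the function vanishes there.\<close>

lemma periodic_bounded:
  fixes f :: "real \<times> (real^'n) \<times> (real^'n) \<Rightarrow> real"
  assumes cont: "continuous_on UNIV f" and per: "lattice_periodic f" and supp: "fibre_support R f"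
  obtains M where "0 \<le> M" "\<And>x. \<bar>f x\<bar> \<le> M"
proof -
  let ?K = "{0..1} \<times> cbox 0 1 \<times> cball 0 R :: (real \<times> (real^'n) \<times> (real^'n)) set"
  have "compact ?K" by (intro compact_Times compact_Icc compact_cbox compact_cball)
  then have "compact (f ` ?K)"
    by (rule compact_continuous_image[rotated]) (rule continuous_on_subset[OF cont], simp)
  then obtain M where M: "\<And>x. x \<in> ?K \<Longrightarrow> \<bar>f x\<bar> \<le> M"
    using compact_imp_bounded bounded_iff by (metis image_eqI real_norm_def)
  have "\<bar>f x\<bar> \<le> max M 0" for x
  proof (cases "R < norm (snd (snd x))")
    case True
    then have "f x = 0" using supp unfolding fibre_support_def by blast
    then show ?thesis by simp
  next
    case False
    obtain t q p where x: "x = (t, q, p)" by (cases x) auto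
    define m where "m = - \<lfloor>t\<rfloor>"
    define z where "z = (\<chi> i. - \<lfloor>q $ i\<rfloor>)"
    have "f x = f (x + (of_int m, real_vec z, 0))"
      by (rule per[unfolded lattice_periodic_def, rule_format, symmetric])
    moreover have "x + (of_int m, real_vec z, 0) \<in> ?K"
    proof -
      have "t + of_int m = frac t" by (simp add: m_def frac_def)
      moreover have "(q + real_vec z) $ i = frac (q $ i)" for i
        by (simp add: z_def real_vec_def frac_def)
      ultimately show ?thesis
        using False by (auto simp: x mem_box_cart less_imp_le[OF frac_lt_1])
    qed
    ultimately show ?thesis using M by (metis max.coboundedI1)
  qed
  then show ?thesis using that[of "max M 0"] by simp
qed

lemma periodic_Lipschitz:
  fixes f :: "real \<times> (real^'n) \<times> (real^'n) \<Rightarrow> real"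
  assumes f: "Ck (Suc 0) f" and per: "lattice_periodic f" and supp: "fibre_support R f"
  obtains B where "0 \<le> B" "\<And>x y. \<bar>f x - f y\<bar> \<le> B * norm (x - y)"
proof -
  let ?D = "\<lambda>x. frechet_derivative f (at x)"
  have diff: "f differentiable (at x)" for x by (rule Ck_differentiable[OF f])
  have "\<exists>M. 0 \<le> M \<and> (\<forall>x. \<bar>?D x b\<bar> \<le> M)" for b
  proof -
    have "continuous_on UNIV (\<lambda>x. ?D x b)" using f by (simp only: Ck.simps)
    then show ?thesis
      using periodic_bounded[OF _ derivative_inherits(1)[OF diff per] derivative_inherits(2)[OF diff supp]]
      by metis
  qed
  then obtain M where M: "\<And>b. 0 \<le> M b" "\<And>b x. \<bar>?D x b\<bar> \<le> M b" by metis
  define B where "B = (\<Sum>b\<in>Basis. M b)"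
  have "\<bar>?D x h\<bar> \<le> B * norm h" for x h
  proof -
    have lin: "linear (?D x)" by (rule linear_frechet_derivative[OF diff])
    have "?D x h = (\<Sum>b\<in>Basis. (h \<bullet> b) * ?D x b)"
      by (subst euclidean_representation[symmetric, of h])
        (simp add: linear_sum[OF lin] linear_cmul[OF lin])
    also have "\<bar>\<dots>\<bar> \<le> (\<Sum>b\<in>Basis. \<bar>(h \<bullet> b) * ?D x b\<bar>)" by (rule sum_abs)
    also have "\<dots> \<le> (\<Sum>b\<in>Basis. norm h * M b)"
      unfolding abs_mult using M by (intro sum_mono mult_mono) (auto simp: Basis_le_norm)
    finally show ?thesis by (simp add: B_def sum_distrib_left mult.commute)
  qed
  then have onorm: "onorm (?D x) \<le> B" for x by (intro onorm_bound) (auto simp: B_def M(1) sum_nonneg)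
  have "norm (f x - f y) \<le> B * norm (x - y)" for x y
    by (rule differentiable_bound[of UNIV f ?D]) (use diff onorm in \<open>auto simp: frechet_derivative_works[symmetric]\<close>)
  then show ?thesis using that[of B] by (simp add: B_def M(1) sum_nonneg)
qed

lemma pullback_periodic:
  fixes H :: "circle \<times> ('n::finite) cotangent \<Rightarrow> real"
  shows "lattice_periodic (pullback H)"
proof -
  have "circle_of (t + of_int m) = circle_of t" for t :: real and m :: int
    by (simp add: circle.abs_eq_iff)
  moreover have "torus_of (q + real_vec z) = torus_of q" for q :: "real^'n" and z
    by (simp add: torus.abs_eq_iff real_vec_def)
  ultimately show ?thesis by (auto simp: lattice_periodic_def pullback_def)
qed

text \<open>The support projects to a compact set of momenta, on which \<open>\<bar>p \<bullet> v\<bar>\<close> attains its maximum.\<close>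

lemma support_in_strip:
  assumes v: "norm v = 1" and r: "r > 0" and H: "H \<in> compactly_supported_smooth (Y r v)"
  obtains R \<epsilon> where "0 \<le> R" "0 < \<epsilon>"
    "\<And>t q p. pullback H (t, q, p) \<noteq> 0 \<Longrightarrow> norm p \<le> R \<and> \<bar>p \<bullet> v\<bar> \<le> r - \<epsilon>"
proof -
  let ?S = "closure {x. H x \<noteq> 0}"
  define P where "P = (\<lambda>x. snd (snd x)) ` ?S"
  have "compact ?S" "?S \<subseteq> UNIV \<times> Y r v" using H by (auto simp: compactly_supported_smooth_def)
  then have P: "compact P" "\<And>p. p \<in> P \<Longrightarrow> \<bar>p \<bullet> v\<bar> < r"
    unfolding P_def using Y_eq[OF v] by (auto intro!: compact_continuous_image continuous_intros)
  have in_P: "p \<in> P" if "pullback H (t, q, p) \<noteq> 0" for t q p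
  proof -
    have "(circle_of t, torus_of q, p) \<in> ?S"
      using that closure_subset by (fastforce simp: pullback_def)
    then show ?thesis unfolding P_def by force
  qed
  obtain R where R: "\<And>p. p \<in> P \<Longrightarrow> norm p \<le> R"
    using compact_imp_bounded[OF P(1)] by (auto simp: bounded_iff)
  have "\<exists>\<epsilon>>0. \<forall>p\<in>P. \<bar>p \<bullet> v\<bar> \<le> r - \<epsilon>"
  proof (cases "P = {}")
    case False
    have "continuous_on P (\<lambda>p. \<bar>p \<bullet> v\<bar>)" by (intro continuous_intros)
    then obtain p0 where p0: "p0 \<in> P" "\<forall>p\<in>P. \<bar>p \<bullet> v\<bar> \<le> \<bar>p0 \<bullet> v\<bar>"
      using continuous_attains_sup[OF P(1) False] by blast
    then show ?thesis using P(2)[OF p0(1)] by (intro exI[of _ "r - \<bar>p0 \<bullet> v\<bar>"]) auto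
  qed (auto intro: exI[of _ 1])
  then obtain \<epsilon> where "\<epsilon> > 0" "\<forall>p\<in>P. \<bar>p \<bullet> v\<bar> \<le> r - \<epsilon>" by blast
  then show ?thesis using that[of "max R 0" \<epsilon>] in_P R by (meson max.coboundedI1 max.cobounded2)
qed

definition grad_q :: "(real \<times> (real^'n) \<times> (real^'n) \<Rightarrow> real) \<Rightarrow> real \<Rightarrow> real^'n \<Rightarrow> real^'n \<Rightarrow> real^'n" where
  "grad_q f t q p = (\<Sum>b\<in>Basis. frechet_derivative f (at (t, q, p)) (0, b, 0) *\<^sub>R b)"

definition grad_p :: "(real \<times> (real^'n) \<times> (real^'n) \<Rightarrow> real) \<Rightarrow> real \<Rightarrow> real^'n \<Rightarrow> real^'n \<Rightarrow> real^'n" where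
  "grad_p f t q p = (\<Sum>b\<in>Basis. frechet_derivative f (at (t, q, p)) (0, 0, b) *\<^sub>R b)"

lemma frechet_grad:
  fixes f :: "real \<times> (real^'n) \<times> (real^'n) \<Rightarrow> real"
  assumes "f differentiable (at (t, q, p))"
  shows "frechet_derivative f (at (t, q, p)) (0, \<xi>, \<eta>) = \<xi> \<bullet> grad_q f t q p + \<eta> \<bullet> grad_p f t q p"
proof -
  let ?D = "frechet_derivative f (at (t, q, p))"
  have lin: "linear ?D" by (rule linear_frechet_derivative[OF assms])
  have 1: "linear (\<lambda>\<xi>. ?D (0, \<xi>, 0))" "linear (\<lambda>\<eta>. ?D (0, 0, \<eta>))"
    by (auto intro!: linearI simp: linear_add[OF lin, symmetric] linear_cmul[OF lin, symmetric]
        simp flip: real_scaleR_def)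
  have 2: "g \<xi> = \<xi> \<bullet> (\<Sum>b\<in>Basis. g b *\<^sub>R b)" if "linear g" for g :: "real^'n \<Rightarrow> real" and \<xi>
    by (subst euclidean_representation[symmetric, of \<xi>])
      (simp add: linear_sum[OF that] linear_cmul[OF that] inner_sum_right mult.commute del: euclidean_representation)
  have "?D (0, \<xi>, \<eta>) = ?D (0, \<xi>, 0) + ?D (0, 0, \<eta>)"
    by (simp add: linear_add[OF lin, symmetric])
  then show ?thesis unfolding grad_q_def grad_p_def using 2[OF 1(1), of \<xi>] 2[OF 1(2), of \<eta>] by argo
qed

text \<open>The Taylor estimate comes from the mean value theorem on the segment from \<open>(q, p)\<close> to
  \<open>(q + \<xi>, p + \<eta>)\<close> together with the Lipschitz bound for the gradient.\<close>

lemma smooth_torus_hamiltonian: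
  fixes f :: "real \<times> (real^'n) \<times> (real^'n) \<Rightarrow> real"
  assumes f: "smooth f" and per: "lattice_periodic f" and supp: "fibre_support R f" and R: "R \<ge> 0"
  obtains M L K C where
    "torus_hamiltonian (\<lambda>t q p. f (t, q, p)) (grad_q f) (grad_p f) M L K C R"
proof -
  have C2: "Ck (Suc (Suc 0)) f" using f unfolding smooth_def by blast
  have C1: "Ck (Suc 0) f" by (rule Ck_Suc_D[OF C2])
  have diff: "f differentiable (at x)" for x by (rule Ck_differentiable[OF C1])
  have contf: "continuous_on UNIV f" using Ck_Suc_D[OF C1] by simp
  let ?D = "\<lambda>w x. frechet_derivative f (at x) w"
  have D1: "Ck (Suc 0) (?D w)" for w using Ck_SucD(2)[OF C2] .
  note Dper = derivative_inherits(1)[OF diff per] and Dsupp = derivative_inherits(2)[OF diff supp]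
  obtain M where M: "0 \<le> M" "\<And>x. \<bar>f x\<bar> \<le> M" using periodic_bounded[OF contf per supp] by blast
  have "\<exists>C. 0 \<le> C \<and> (\<forall>x. \<bar>?D w x\<bar> \<le> C)" for w
    using periodic_bounded[OF _ Dper Dsupp] Ck_Suc_D[OF D1] by (metis Ck.simps(1))
  then obtain C where C: "\<And>w. 0 \<le> C w" "\<And>w x. \<bar>?D w x\<bar> \<le> C w" by metis
  have "\<exists>B. 0 \<le> B \<and> (\<forall>x y. \<bar>?D w x - ?D w y\<bar> \<le> B * norm (x - y))" for w
    using periodic_Lipschitz[OF D1 Dper Dsupp] by metis
  then obtain B where B: "\<And>w. 0 \<le> B w" "\<And>w x y. \<bar>?D w x - ?D w y\<bar> \<le> B w * norm (x - y)" by metis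
  \<comment> \<open>\<open>i True\<close> and \<open>i False\<close> embed the \<open>q\<close>- and the \<open>p\<close>-directions, so that both gradients are treated at once\<close>
  define i :: "bool \<Rightarrow> real^'n \<Rightarrow> real \<times> (real^'n) \<times> (real^'n)"
    where "i k b = (if k then (0, b, 0) else (0, 0, b))" for k b
  define g where "g k x = (\<Sum>b\<in>Basis. ?D (i k b) x *\<^sub>R b)" for k x
  have g: "grad_q f t q p = g True (t, q, p)" "grad_p f t q p = g False (t, q, p)" for t q p
    by (simp_all add: g_def i_def grad_q_def grad_p_def)
  define CC where "CC = (\<Sum>b\<in>Basis. C (i True b)) + (\<Sum>b\<in>Basis. C (i False b))"
  define K where "K = (\<Sum>b\<in>Basis. B (i True b)) + (\<Sum>b\<in>Basis. B (i False b))"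
  have nn: "0 \<le> (\<Sum>b\<in>Basis. C (i k b))" "0 \<le> (\<Sum>b\<in>Basis. B (i k b))" for k
    by (simp_all add: C B sum_nonneg)
  have CC: "CC \<ge> 0" "(\<Sum>b\<in>Basis. C (i k b)) \<le> CC" for k
    using nn(1)[of True] nn(1)[of False] by (cases k; simp add: CC_def)+
  have K: "K \<ge> 0" "(\<Sum>b\<in>Basis. B (i k b)) \<le> K" for k
    using nn(2)[of True] nn(2)[of False] by (cases k; simp add: K_def)+
  have g_bd: "norm (g k x) \<le> CC" for k x
  proof -
    have "norm (g k x) \<le> (\<Sum>b\<in>Basis. C (i k b))"
      unfolding g_def by (rule sum_norm_le) (use C in auto)
    then show ?thesis using CC(2)[of k] by linarith
  qed
  have g_Lip: "norm (g k (t, q, p) - g k (s, y, p')) \<le> K * (\<bar>t - s\<bar> + norm (q - y) + norm (p - p'))"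
    for k t q p s y p'
  proof -
    let ?d = "(t, q, p) - (s, y, p')"
    have "norm (g k (t, q, p) - g k (s, y, p')) \<le> (\<Sum>b\<in>Basis. B (i k b) * norm ?d)"
      unfolding g_def sum_subtractf[symmetric] scaleR_diff_left[symmetric]
    proof (rule sum_norm_le)
      fix b :: "real^'n" assume "b \<in> Basis"
      then show "norm ((?D (i k b) (t, q, p) - ?D (i k b) (s, y, p')) *\<^sub>R b) \<le> B (i k b) * norm ?d"
        using B(2)[where w = "i k b" and x = "(t, q, p)" and y = "(s, y, p')"] by simp
    qed
    also have "\<dots> \<le> K * norm ?d"
      unfolding sum_distrib_right[symmetric] by (intro mult_right_mono K) auto
    also have "norm ?d \<le> \<bar>t - s\<bar> + (norm (q - y) + norm (p - p'))"
      using norm_Pair_le[of "t - s" "(q - y, p - p')"] norm_Pair_le[of "q - y" "p - p'"] by simp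
    finally show ?thesis using K(1) by (simp add: add.assoc mult_left_mono)
  qed
  have Taylor: "f (t, q, p) + \<xi> \<bullet> grad_q f t q p + \<eta> \<bullet> grad_p f t q p - (2 * K) * ((norm \<xi>)\<^sup>2 + (norm \<eta>)\<^sup>2)
      \<le> f (t, q + \<xi>, p + \<eta>)" for t q p \<xi> \<eta>
  proof -
    let ?z = "(0, \<xi>, \<eta>)" and ?x = "(t, q, p)"
    have "((\<lambda>s. f (?x + s *\<^sub>R ?z)) has_real_derivative ?D ?z (?x + s *\<^sub>R ?z)) (at s)" for s
    proof -
      have "((\<lambda>s. ?x + s *\<^sub>R ?z) has_derivative (\<lambda>h. h *\<^sub>R ?z)) (at s)"
        by (auto intro!: derivative_eq_intros)
      then have "((\<lambda>s. f (?x + s *\<^sub>R ?z)) has_derivative (\<lambda>h. frechet_derivative f (at (?x + s *\<^sub>R ?z)) (h *\<^sub>R ?z))) (at s)"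
        by (rule has_derivative_compose) (simp add: diff frechet_derivative_works[symmetric])
      moreover have "frechet_derivative f (at (?x + s *\<^sub>R ?z)) (h *\<^sub>R ?z) = ?D ?z (?x + s *\<^sub>R ?z) * h" for h
        using linear_cmul[OF linear_frechet_derivative[OF diff]] by (simp only: real_scaleR_def mult.commute)
      ultimately show ?thesis unfolding has_field_derivative_def by simp
    qed
    then obtain s where s: "0 < s" "s < 1" "f (?x + 1 *\<^sub>R ?z) - f (?x + 0 *\<^sub>R ?z) = (1 - 0) * ?D ?z (?x + s *\<^sub>R ?z)"
      using MVT2[of 0 1 "\<lambda>s. f (?x + s *\<^sub>R ?z)" "\<lambda>s. ?D ?z (?x + s *\<^sub>R ?z)"] by auto
    let ?q = "q + s *\<^sub>R \<xi>" and ?p = "p + s *\<^sub>R \<eta>"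
    have "f (t, q + \<xi>, p + \<eta>) - f ?x = \<xi> \<bullet> g True (t, ?q, ?p) + \<eta> \<bullet> g False (t, ?q, ?p)"
      using s(3) frechet_grad[OF diff, of t ?q ?p \<xi> \<eta>] by (simp add: g)
    moreover have "\<zeta> \<bullet> g k (t, q, p) - \<zeta> \<bullet> g k (t, ?q, ?p) \<le> norm \<zeta> * (K * (norm \<xi> + norm \<eta>))" for \<zeta> k
    proof -
      have "\<zeta> \<bullet> g k (t, q, p) - \<zeta> \<bullet> g k (t, ?q, ?p) \<le> norm \<zeta> * norm (g k (t, q, p) - g k (t, ?q, ?p))"
        unfolding inner_diff_right[symmetric] by (rule norm_cauchy_schwarz)
      also have "norm (g k (t, q, p) - g k (t, ?q, ?p)) \<le> K * (\<bar>t - t\<bar> + norm (q - ?q) + norm (p - ?p))"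
        by (rule g_Lip)
      also have "\<dots> \<le> K * (norm \<xi> + norm \<eta>)"
        using s K(1) by (intro mult_left_mono) (auto intro!: add_mono simp: mult_left_le_one_le)
      finally show ?thesis by (simp add: mult_left_mono)
    qed
    from this[of \<xi> True] this[of \<eta> False]
    have "\<xi> \<bullet> g True (t, q, p) - \<xi> \<bullet> g True (t, ?q, ?p) + (\<eta> \<bullet> g False (t, q, p) - \<eta> \<bullet> g False (t, ?q, ?p))
        \<le> K * (norm \<xi> + norm \<eta>)\<^sup>2"
      by (simp add: power2_eq_square algebra_simps)
    moreover have "K * (norm \<xi> + norm \<eta>)\<^sup>2 \<le> K * (2 * ((norm \<xi>)\<^sup>2 + (norm \<eta>)\<^sup>2))"
      using K(1) by (intro mult_left_mono) (use sum_squares_bound[of "norm \<xi>" "norm \<eta>"] in \<open>simp_all add: power2_sum\<close>)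
    ultimately show ?thesis unfolding g by (simp add: algebra_simps)
  qed
  have gper: "g k (t + of_int m, q + real_vec z, p) = g k (t, q, p)" for k t m q z p
    unfolding g_def
    using Dper[unfolded lattice_periodic_def, rule_format, where x = "(t, q, p)" and m = m and z = z] by simp
  have "torus_hamiltonian (\<lambda>t q p. f (t, q, p)) (grad_q f) (grad_p f) (M + 1) (2 * K) K CC R"
  proof
    show "continuous_on UNIV (\<lambda>w. f (t, fst w, snd w))" for t
      by (rule continuous_on_compose2[OF contf]) (auto intro!: continuous_intros)
    show "\<bar>f (t, q, p)\<bar> \<le> M + 1" for t q p using M(2)[of "(t, q, p)"] by simp
    show "norm p \<le> R" if "f (t, q, p) \<noteq> 0" for t q p
      using that supp by (force simp: fibre_support_def not_less[symmetric])
    show "norm p \<le> R" if "grad_p f t q p \<noteq> 0" for t q p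
    proof (rule ccontr)
      assume "\<not> norm p \<le> R"
      then have "?D w (t, q, p) = 0" for w using Dsupp[of w] by (simp add: fibre_support_def)
      then show False using that by (simp add: grad_p_def)
    qed
  qed (use Taylor g_Lip g_bd gper M K CC R in \<open>simp_all add: g\<close>)
  then show ?thesis by (rule that)
qed

text \<open>Values at the representative of a point of the circle differ from those at any other
  representative by a lattice vector, so the choice of representatives does not matter.\<close>

lemma loop_of_curve:
  assumes "continuous_on UNIV q" "continuous_on UNIV p"
    "\<And>t. q (t + 1) = q t + real_vec \<alpha>" "\<And>t. p (t + 1) = p t"
  shows "lift_of_loop (\<lambda>c. (torus_of (q (rep_circle c)), p (rep_circle c))) q p"
proof -
  have nat: "q (t + real n) = q t + real_vec (\<chi> i. int n * \<alpha> $ i) \<and> p (t + real n) = p t" for t and n :: nat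
  proof (induction n)
    case 0
    then show ?case by (simp add: real_vec_def vec_eq_iff)
  next
    case (Suc n)
    have "t + real (Suc n) = (t + real n) + 1" by simp
    then show ?case using assms(3,4)[of "t + real n"] Suc
      by (simp add: real_vec_def vec_eq_iff algebra_simps)
  qed
  have shift: "torus_of (q s) = torus_of (q t) \<and> p s = p t" if d: "s - t \<in> \<int>" "t \<le> s" for s t
  proof -
    obtain m where m: "s - t = of_int m" using d(1) Ints_cases by blast
    then have "s = t + real (nat m)" using d(2) by simp
    then have "q s = q t + real_vec (\<chi> i. int (nat m) * \<alpha> $ i)" "p s = p t" using nat by blast+
    then show ?thesis by (simp add: torus.abs_eq_iff real_vec_def)
  qed
  have "torus_of (q (rep_circle (circle_of t))) = torus_of (q t) \<and> p (rep_circle (circle_of t)) = p t" for t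
  proof -
    have "circle_of (rep_circle (circle_of t)) = circle_of t"
      by (rule Quotient3_abs_rep[OF Quotient3_circle])
    then have "rep_circle (circle_of t) - t \<in> \<int>" unfolding circle.abs_eq_iff .
    moreover from this have "t - rep_circle (circle_of t) \<in> \<int>" by (metis Ints_minus minus_diff_eq)
    ultimately show ?thesis
      using shift[of "rep_circle (circle_of t)" t] shift[of t "rep_circle (circle_of t)"] by fastforce
  qed
  then show ?thesis using assms(1,2) by (simp add: lift_of_loop_def)
qed

text \<open>The existence result is one-sided in \<open>p \<bullet> v\<close>; as the strip is symmetric, replacing \<open>v\<close> by \<open>- v\<close>
  makes the class a positive multiple of \<open>v\<close>.\<close>

lemma periodic_orbit_exists:
  fixes v :: "real^'n" and \<alpha> :: "int^'n"
  assumes v: "norm v = 1" and r: "r > 0" and \<alpha>: "real_vec \<alpha> = \<kappa> *\<^sub>R v" "\<kappa> \<noteq> 0"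
    and c: "r * \<bar>\<kappa>\<bar> < c" and H: "H \<in> BPS_class c (Y r v) zero_section"
  shows "periodic_orbits \<alpha> H \<noteq> {}"
proof -
  define f where "f = pullback H"
  have Hs: "H \<in> compactly_supported_smooth (Y r v)" and Hc: "(SUP x\<in>UNIV \<times> zero_section. ereal (H x)) \<le> ereal (- c)"
    using H by (auto simp: BPS_class_def)
  obtain R \<epsilon> where R: "0 \<le> R" "0 < \<epsilon>"
    "\<And>t q p. f (t, q, p) \<noteq> 0 \<Longrightarrow> norm p \<le> R \<and> \<bar>p \<bullet> v\<bar> \<le> r - \<epsilon>"
    using support_in_strip[OF v r Hs] unfolding f_def by blast
  have sm: "smooth f" using Hs by (simp add: f_def compactly_supported_smooth_def)
  have per: "lattice_periodic f" unfolding f_def by (rule pullback_periodic)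
  have supp: "fibre_support R f" unfolding fibre_support_def using R(3) by (metis not_less prod.collapse)
  obtain M L K C where "torus_hamiltonian (\<lambda>t q p. f (t, q, p)) (grad_q f) (grad_p f) M L K C R"
    by (rule smooth_torus_hamiltonian[OF sm per supp R(1)])
  then interpret torus_hamiltonian "\<lambda>t q p. f (t, q, p)" "grad_q f" "grad_p f" M L K C R .
  define v' where "v' = sgn \<kappa> *\<^sub>R v"
  have v': "norm v' = 1" "real_vec \<alpha> = \<bar>\<kappa>\<bar> *\<^sub>R v'" "\<bar>\<kappa>\<bar> > 0"
    using v \<alpha> mult_sgn_abs[of \<kappa>] by (simp_all add: v'_def abs_sgn_eq mult.commute)
  have 1: "p \<bullet> v' \<le> r - \<epsilon>" if "f (t, q, p) \<noteq> 0" for t q p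
  proof -
    have "p \<bullet> v' \<le> \<bar>p \<bullet> v\<bar>" by (auto simp: v'_def sgn_if)
    then show ?thesis using R(3)[OF that] by linarith
  qed
  have 2: "f (t, q, 0) \<le> - c" for t q
  proof -
    have "ereal (H (circle_of t, torus_of q, 0)) \<le> ereal (- c)"
      by (rule order_trans[OF SUP_upper Hc]) (simp add: zero_section_def)
    then show ?thesis by (simp add: f_def pullback_def)
  qed
  obtain q p where qp: "\<And>t. (q has_vector_derivative grad_p f t (q t) (p t)) (at t)"
    "\<And>t. (p has_vector_derivative - grad_q f t (q t) (p t)) (at t)"
    "\<And>t. q (t + 1) = q t + real_vec \<alpha>" "\<And>t. p (t + 1) = p t"
    by (rule orbit_exists[OF v' R(2) r _ 2 c]) (rule 1, assumption, rule that)
  have cont: "continuous_on UNIV q" "continuous_on UNIV p"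
    using qp(1,2) by (meson continuous_at_imp_continuous_on has_vector_derivative_continuous)+
  have "f differentiable (at x)" for x
    using sm Ck_differentiable unfolding smooth_def by blast
  then have D: "(f has_derivative frechet_derivative f (at x)) (at x)"
    and G: "frechet_derivative f (at (t, q, p)) (0, \<xi>, \<eta>) = \<xi> \<bullet> grad_q f t q p + \<eta> \<bullet> grad_p f t q p" for x t q p \<xi> \<eta>
    by (simp_all add: frechet_derivative_works[symmetric] frechet_grad)
  have "GDERIV (\<lambda>y. f (t, q t, y)) (p t) :> grad_p f t (q t) (p t)" for t
  proof -
    have "((\<lambda>y. (t, q t, y)) has_derivative (\<lambda>h. (0, 0, h))) (at (p t))"
      by (auto intro!: derivative_eq_intros)
    from has_derivative_compose[OF this D] show ?thesis by (simp add: gderiv_def G)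
  qed
  moreover have "GDERIV (\<lambda>x. f (t, x, p t)) (q t) :> grad_q f t (q t) (p t)" for t
  proof -
    have "((\<lambda>x. (t, x, p t)) has_derivative (\<lambda>h. (0, h, 0))) (at (q t))"
      by (auto intro!: derivative_eq_intros)
    from has_derivative_compose[OF this D] show ?thesis by (simp add: gderiv_def G)
  qed
  ultimately have "hamilton_eqs H q p"
    unfolding hamilton_eqs_def f_def[symmetric] using qp(1,2) by (metis minus_minus)
  then show ?thesis
    using loop_of_curve[OF cont qp(3,4)] qp(3) unfolding periodic_orbits_def by blast
qed

section \<open>The capacity of the strip\<close>

lemma C_BPS_le:
  fixes v :: "real^'n"
  assumes v: "norm v = 1" and r: "r > 0" and \<alpha>: "real_vec \<alpha> = \<kappa> *\<^sub>R v" "\<kappa> \<noteq> 0"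
  shows "C_BPS (Y r v) zero_section \<alpha> \<le> ereal (r * \<bar>\<kappa>\<bar>)"
proof (rule dense_ge)
  fix x assume x: "ereal (r * \<bar>\<kappa>\<bar>) < x"
  show "C_BPS (Y r v) zero_section \<alpha> \<le> x"
  proof (cases x)
    case (real c)
    then have c: "r * \<bar>\<kappa>\<bar> < c" using x by simp
    moreover have "0 \<le> r * \<bar>\<kappa>\<bar>" using r by simp
    ultimately have "0 < c" by linarith
    then show ?thesis
      unfolding C_BPS_def real
      by (intro Inf_lower) (use periodic_orbit_exists[OF v r \<alpha> c] in blast)
  qed (use x in auto)
qed

lemma C_BPS_eq:
  fixes v :: "real^'n"
  assumes v: "norm v = 1" and r: "r > 0" and \<alpha>: "real_vec \<alpha> = \<kappa> *\<^sub>R v" "\<kappa> \<noteq> 0"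
  shows "C_BPS (Y r v) zero_section \<alpha> = ereal (r * norm (real_vec \<alpha>))"
proof (rule antisym)
  have n: "norm (real_vec \<alpha>) = \<bar>\<kappa>\<bar>" using v \<alpha> by simp
  show "C_BPS (Y r v) zero_section \<alpha> \<le> ereal (r * norm (real_vec \<alpha>))"
    unfolding n by (rule C_BPS_le[OF assms])
  have "\<bar>real_vec \<alpha> \<bullet> v\<bar> = \<bar>\<kappa>\<bar>" using v by (simp add: \<alpha> norm_eq_1)
  then show "ereal (r * norm (real_vec \<alpha>)) \<le> C_BPS (Y r v) zero_section \<alpha>"
    unfolding n by (rule C_BPS_ge[OF v r])
qed

theorem theorem1p18:
  fixes v :: "real^'n"
  assumes "norm v = 1"
  shows
    "(\<forall>\<alpha>::int^'n. \<alpha> \<noteq> 0 \<and> (\<exists>s. v = s *\<^sub>R real_vec \<alpha>) \<longrightarrow>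
        (\<forall>r>0. C_BPS (Y r v) zero_section \<alpha> = ereal (r * norm (real_vec \<alpha>)) \<and>
               C_BPS (Y r v) zero_section (- \<alpha>) = ereal (r * norm (real_vec \<alpha>))) \<and>
        (\<forall>\<beta>. real_vec \<beta> \<notin> span {real_vec \<alpha>} \<longrightarrow>
           (\<forall>r>0. C_BPS (Y r v) zero_section \<beta> = \<infinity>)))
     \<and>
     ((\<nexists>s (\<alpha>::int^'n). v = s *\<^sub>R real_vec \<alpha>) \<longrightarrow>
        (\<forall>\<alpha>::int^'n. \<alpha> \<noteq> 0 \<longrightarrow> (\<forall>r>0. C_BPS (Y r v) zero_section \<alpha> = \<infinity>)))"
proof (intro conjI allI impI)
  fix \<alpha> :: "int^'n" and r :: real
  assume *: "\<alpha> \<noteq> 0 \<and> (\<exists>s. v = s *\<^sub>R real_vec \<alpha>)"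
  then obtain s where s: "v = s *\<^sub>R real_vec \<alpha>" by blast
  then have s0: "s \<noteq> 0" using assms by auto
  then have \<alpha>: "real_vec \<alpha> = (1 / s) *\<^sub>R v" "real_vec (- \<alpha>) = (- 1 / s) *\<^sub>R v"
    using s by (simp_all add: real_vec_simps)
  show "C_BPS (Y r v) zero_section \<alpha> = ereal (r * norm (real_vec \<alpha>))" if "r > 0"
    by (rule C_BPS_eq[OF assms that \<alpha>(1)]) (use s0 in simp)
  have "C_BPS (Y r v) zero_section (- \<alpha>) = ereal (r * norm (real_vec (- \<alpha>)))" if "r > 0"
    by (rule C_BPS_eq[OF assms that \<alpha>(2)]) (use s0 in simp)
  then show "C_BPS (Y r v) zero_section (- \<alpha>) = ereal (r * norm (real_vec \<alpha>))" if "r > 0"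
    using that by (simp add: real_vec_simps)
  fix \<beta> :: "int^'n" assume "real_vec \<beta> \<notin> span {real_vec \<alpha>}"
  then have "real_vec \<beta> \<noteq> (real_vec \<beta> \<bullet> v) *\<^sub>R v"
    by (metis s span_base span_mul singletonI)
  then show "C_BPS (Y r v) zero_section \<beta> = \<infinity>" if "r > 0"
    by (rule C_BPS_infinite[OF assms that])
next
  fix \<alpha> :: "int^'n" and r :: real
  assume *: "\<nexists>s (\<alpha>::int^'n). v = s *\<^sub>R real_vec \<alpha>" and \<alpha>: "\<alpha> \<noteq> 0" and r: "r > 0"
  have "real_vec \<alpha> \<noteq> (real_vec \<alpha> \<bullet> v) *\<^sub>R v"
  proof
    assume eq: "real_vec \<alpha> = (real_vec \<alpha> \<bullet> v) *\<^sub>R v"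
    have "real_vec \<alpha> \<noteq> 0" using \<alpha> by (auto simp: real_vec_def vec_eq_iff)
    then have "real_vec \<alpha> \<bullet> v \<noteq> 0" using eq by auto
    then have "v = (1 / (real_vec \<alpha> \<bullet> v)) *\<^sub>R real_vec \<alpha>" by (subst eq) simp
    then show False using * by blast
  qed
  then show "C_BPS (Y r v) zero_section \<alpha> = \<infinity>" by (rule C_BPS_infinite[OF assms r])
qed

end
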